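(* Let $$f(z)=\exp(e^z-1)=\sum_{n=0}^\infty b_nz^n\quad\text{and}\quad g(z)=\sum_{n=0}^\infty b_{n^2}z^{n^2}.$$ Then $g$ is a log-regular transcendental entire function of infinite order, and $A_R(g)$ is a spider's web, where $R>0$ is such that $M(r,g)>r$ for $r\ge R$.
   Context: For an entire function $f$ put $M(r,f)=\max_{|z|=r}|f(z)|$ for $r>0$. The order of a transcendental entire function $f$ is $\rho(f)=\limsup_{r\to\infty}\frac{\log\log M(r,f)}{\log r}$. $f^n$ is the $n$th iterate of $f$, and $M^n(R,f)$ is the $n$th iterate of the map $r\mapsto M(r,f)$ applied to $R$. $\mathbb N=\{1,2,\ldots\}$. For a transcendental entire function $f$ and $R>0$ with $M(r,f)>r$ for all $r\ge R$, define $A_R(f)=\{z\in\mathbb C: |f^n(z)|\ge M^n(R,f)\text{ for } n\in\mathbb N\}$. A set $E\subset\mathbb C$ is a spider's web if $E$ is connected and there is a sequence $(G_n)_{n\in\mathbb N}$ of bounded simply connected domains with $G_n\subset G_{n+1}$ and $\partial G_n\subset E$ for all $n\in\mathbb N$, and $\bigcup_{n\in\mathbb N}G_n=\mathbb C$. A transcendental entire function $f$ is log-regular (with constant $c>0$) if $\phi(t)=\log M(e^t,f)$ satisfies $\phi'(t)/\phi(t)\ge (1+c)/t$ for all large $t$; it is log-regular if this holds for some $c>0$. (Since $\phi$ is convex, $\phi'$ exists outside a countable set; at exceptional points $\phi'$ is read as the right derivative.) *)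

theory Defs
  imports "HOL-Complex_Analysis.Complex_Analysis"
begin

definition transcendental_entire :: "(complex \<Rightarrow> complex) \<Rightarrow> bool" where
  "transcendental_entire f \<longleftrightarrow>
     f holomorphic_on UNIV \<and> \<not> (\<exists>p :: complex poly. \<forall>z. f z = poly p z)"

(* The supremum is a maximum for continuous f and r >= 0, the sphere being compact. *)
definition max_modulus :: "real \<Rightarrow> (complex \<Rightarrow> complex) \<Rightarrow> real" where
  "max_modulus r f = (SUP z\<in>sphere 0 r. norm (f z))"

definition growth_order :: "(complex \<Rightarrow> complex) \<Rightarrow> ereal" where
  "growth_order f = Limsup at_top (\<lambda>r. ereal (ln (ln (max_modulus r f)) / ln r))"

definition log_max_modulus :: "(complex \<Rightarrow> complex) \<Rightarrow> real \<Rightarrow> real" where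
  "log_max_modulus f t = ln (max_modulus (exp t) f)"

(* D is the right derivative of log_max_modulus f at t; it agrees with the derivative
   wherever the latter exists. *)
definition log_regular_with :: "real \<Rightarrow> (complex \<Rightarrow> complex) \<Rightarrow> bool" where
  "log_regular_with c f \<longleftrightarrow>
     (\<forall>\<^sub>F t in at_top. \<exists>D. (log_max_modulus f has_real_derivative D) (at_right t) \<and>
        D / log_max_modulus f t \<ge> (1 + c) / t)"

definition log_regular :: "(complex \<Rightarrow> complex) \<Rightarrow> bool" where
  "log_regular f \<longleftrightarrow> transcendental_entire f \<and> (\<exists>c>0. log_regular_with c f)"

(* A_R(f); meaningful when max_modulus r f > r for all r >= R. *)
definition A_set :: "real \<Rightarrow> (complex \<Rightarrow> complex) \<Rightarrow> complex set" where
  "A_set R f =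
     {z. \<forall>n\<ge>1. norm ((f ^^ n) z) \<ge> ((\<lambda>r. max_modulus r f) ^^ n) R}"

(* A domain is a nonempty connected open set. *)
definition spiders_web :: "complex set \<Rightarrow> bool" where
  "spiders_web E \<longleftrightarrow> connected E \<and>
     (\<exists>G :: nat \<Rightarrow> complex set.
        (\<forall>n. G n \<noteq> {} \<and> open (G n) \<and> connected (G n) \<and> simply_connected (G n) \<and> bounded (G n)
             \<and> G n \<subseteq> G (Suc n) \<and> frontier (G n) \<subseteq> E) \<and>
        (\<Union>n. G n) = UNIV)"

end

theory Submission
  imports Defs "HOL-Real_Asymp.Real_Asymp"
begin

text \<open>
  Write \<open>g z = \<Sum>n a\<^sub>n z\<^bsup>n\<^sup>2\<^esup>\<close> with \<open>a\<^sub>n > 0\<close>, so that \<open>M(r, g) = g(r) =: G r\<close>. The only information on the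
  coefficients that enters is \<open>exp (exp (r / 48)) \<le> G r \<le> exp (exp r)\<close>; it gives the infinite order
  at once, and log-regularity because \<open>\<phi>(t) = ln (G (exp t))\<close> is convex and \<open>\<phi>(t / 2)\<close> is small
  compared with \<open>\<phi>(t)\<close>.

  For the spider's web it suffices that on every connected set joining \<open>|z| = x\<close> to \<open>|z| = 3x\<close>,
  for \<open>x\<close> large, \<open>|g|\<close> is somewhere at least \<open>sqrt (G (x / 2))\<close>, which is far above \<open>3 (G (sqrt x))\<^sup>2\<close>:
  iterating this, a connected set that contains \<open>0\<close> and a point of large modulus meets
  \<open>{z. |g\<^sup>n(z)| \<ge> M\<^sup>n(S)}\<close> for every \<open>n\<close>. The lower bound for \<open>|g|\<close> comes from three facts. The
  exponents being squares, \<open>g (exp w)\<close> extends to a solution of the backward heat equation, whence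
  \<open>g\<close> is almost as large as \<open>G r\<close> in every disc of fixed radius centred on \<open>|z| = r\<close>. Since \<open>G\<close> has
  at most double exponential growth, there are many \<open>r\<close> for which \<open>ln (G (r + \<delta>))\<close> is at most
  \<open>9/8 ln (G (r - \<delta>'))\<close>. Finally, on such a disc, polynomial interpolation in points of the connected set
  transfers the lower bound to that set.
\<close>

section \<open>A criterion for spider's webs\<close>

text \<open>The complement \<open>U\<close> of the escaping set is the increasing union of the sets \<open>|f\<^sup>n| < m\<^sup>n(R)\<close>, so the
  maximum principle makes its components simply connected. If the set were disconnected, then one
  of the loops \<open>\<partial>G\<^sub>n\<close> in it would cut off a compact relatively open piece, which a contour in
  \<open>U\<close> surrounds: this contradicts the maximum principle again.\<close>

lemma spiders_web_criterion:
  fixes f :: "complex \<Rightarrow> complex" and m :: "real \<Rightarrow> real"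
  assumes hol: "f holomorphic_on UNIV"
    and bound: "\<And>z. norm (f z) \<le> m (norm z)"
    and mono: "strict_mono_on {0..} m"
    and nonneg: "\<And>r. 0 \<le> r \<Longrightarrow> 0 \<le> m r"
    and "0 < R" "0 < S0"
    and cross: "\<And>S. S0 \<le> S \<Longrightarrow> \<exists>\<rho>. \<forall>K. connected K \<longrightarrow> 0 \<in> K \<longrightarrow> (\<exists>w\<in>K. \<rho> \<le> norm w)
                  \<longrightarrow> (\<forall>n. \<exists>z\<in>K. (m ^^ n) S \<le> norm ((f ^^ n) z))"
  shows "spiders_web {z. \<forall>n\<ge>1. (m ^^ n) R \<le> norm ((f ^^ n) z)}"
proof -

  \<comment> \<open>Sublevel sets of iterates and the maximum principle\<close>
  define U where "U S = {z. \<exists>n\<ge>1. norm ((f ^^ n) z) < (m ^^ n) S}" for S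
  define A where "A S = {z. \<forall>n\<ge>1. (m ^^ n) S \<le> norm ((f ^^ n) z)}" for S
  have AU: "A S = - U S" for S
    by (auto simp: A_def U_def not_less)
  have iter_hol: "(f ^^ n) holomorphic_on UNIV" for n
  proof (induction n)
    case (Suc n)
    then show ?case using holomorphic_on_compose_gen[OF Suc hol] by (simp add: o_def)
  qed (simp add: id_def)
  then have iter_cont: "continuous_on T (f ^^ n)" for n T
    using continuous_on_subset holomorphic_on_imp_continuous_on by blast
  have mless: "m x < m y" if "0 \<le> x" "x < y" for x y
    using mono that by (auto simp: strict_mono_on_def)
  have mle: "m x \<le> m y" if "0 \<le> x" "x \<le> y" for x y
    using mless[of x y] that by (cases "x = y") auto
  have iter_nonneg: "0 \<le> (m ^^ n) S" if "0 \<le> S" for n S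
    by (induction n) (auto simp: that nonneg)
  have iter_mono: "(m ^^ n) S \<le> (m ^^ n) T" if "0 \<le> S" "S \<le> T" for n S T
    by (induction n) (auto simp: that intro!: mle iter_nonneg)
  \<comment> \<open>An orbit once below stays below, so the sets \<open>|f^n| < m^n(S)\<close>
    increase with \<open>n\<close>; a compact subset of \<open>U S\<close> therefore lies in one of
    them.\<close>
  have iter_step: "norm ((f ^^ (n + k)) z) < (m ^^ (n + k)) S"
    if "norm ((f ^^ n) z) < (m ^^ n) S" for n k z S
  proof (induction k)
    case (Suc k)
    have "norm ((f ^^ (n + Suc k)) z) \<le> m (norm ((f ^^ (n + k)) z))"
      using bound by simp
    also have "\<dots> < m ((m ^^ (n + k)) S)"
      by (rule mless) (use Suc in auto)
    finally show ?case by simp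
  qed (use that in simp)
  have openU: "open (U S)" for S
  proof -
    have "U S = (\<Union>n\<in>{1..}. {z. norm ((f ^^ n) z) < (m ^^ n) S})"
      by (auto simp: U_def)
    moreover have "open {z. norm ((f ^^ n) z) < (m ^^ n) S}" for n
      by (intro open_Collect_less continuous_intros iter_cont)
    ultimately show ?thesis by auto
  qed
  have ballU: "ball 0 S \<subseteq> U S" for S
    using iter_step[of 0 _ S 1] by (fastforce simp: U_def)
  have U_mono: "U S \<subseteq> U T" if "0 \<le> S" "S \<le> T" for S T
    using iter_mono[OF that] unfolding U_def by (force intro: less_le_trans)
  have compactU: "\<exists>n\<ge>1. \<forall>z\<in>K. norm ((f ^^ n) z) < (m ^^ n) S" if K: "compact K" "K \<subseteq> U S" for K S
  proof -
    have "\<exists>D \<subseteq> {1::nat..}. finite D \<and> K \<subseteq> (\<Union>n\<in>D. {z. norm ((f ^^ n) z) < (m ^^ n) S})"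
      by (rule compactE_image[OF K(1), of "{1..}" "\<lambda>n. {z. norm ((f ^^ n) z) < (m ^^ n) S}"])
         (use K(2) in \<open>auto simp: U_def intro!: open_Collect_less continuous_intros iter_cont\<close>)
    then obtain D where D: "finite D" "K \<subseteq> (\<Union>n\<in>D. {z. norm ((f ^^ n) z) < (m ^^ n) S})"
      by blast
    have "norm ((f ^^ Max (insert 1 D)) z) < (m ^^ Max (insert 1 D)) S" if z: "z \<in> K" for z
    proof -
      obtain n where n: "n \<in> D" "norm ((f ^^ n) z) < (m ^^ n) S"
        using D z by blast
      moreover have "n \<le> Max (insert 1 D)" using D(1) n(1) by simp
      ultimately show ?thesis
        using iter_step[of n z S "Max (insert 1 D) - n"] by simp
    qed
    moreover have "1 \<le> Max (insert 1 D)" using D(1) by simp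
    ultimately show ?thesis by blast
  qed
  \<comment> \<open>One iterate is below \<open>m^n(S)\<close> on the whole compact frontier, hence
    on \<open>V\<close>.\<close>
  have max_principle: "V \<subseteq> U S" if V: "open V" "bounded V" "frontier V \<subseteq> U S" for V S
  proof -
    have "compact (frontier V)" using V by (simp add: compact_frontier_bounded)
    then obtain n where n: "n \<ge> 1" "\<And>z. z \<in> frontier V \<Longrightarrow> norm ((f ^^ n) z) < (m ^^ n) S"
      using compactU[OF \<open>compact (frontier V)\<close> V(3)] by blast
    show ?thesis
    proof (cases "V = {}")
      case False
      then have "frontier V \<noteq> {}"
        using V by (metis frontier_eq_empty not_bounded_UNIV)
      moreover have "continuous_on (frontier V) (\<lambda>z. norm ((f ^^ n) z))"
        by (intro continuous_intros iter_cont)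
      ultimately obtain w where w: "w \<in> frontier V"
          "\<And>z. z \<in> frontier V \<Longrightarrow> norm ((f ^^ n) z) \<le> norm ((f ^^ n) w)"
        using continuous_attains_sup[OF \<open>compact (frontier V)\<close>] by blast
      have "norm ((f ^^ n) z) \<le> norm ((f ^^ n) w)" if "z \<in> V" for z
        by (rule maximum_modulus_frontier[of "f ^^ n" V])
           (use V w that iter_cont holomorphic_on_subset[OF iter_hol] in auto)
      then have "norm ((f ^^ n) z) < (m ^^ n) S" if "z \<in> V" for z
        using n(2)[OF w(1)] that by (rule_tac le_less_trans)
      then show ?thesis using n(1) by (auto simp: U_def)
    qed auto
  qed

  \<comment> \<open>The component of \<open>U S\<close> around the origin\<close>
  define G where "G S = connected_component_set (U S) 0" for S
  have openG: "open (G S)" and connG: "connected (G S)" and GU: "G S \<subseteq> U S" for S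
    by (auto simp: G_def openU open_connected_component connected_component_subset)
  have ballG: "ball 0 S \<subseteq> G S" if "0 < S" for S
    unfolding G_def by (rule connected_component_maximal) (use that ballU in auto)
  have frontG: "frontier (G S) \<subseteq> A S" for S
  proof -
    have "frontier (G S) \<subseteq> frontier (U S)"
      unfolding G_def by (rule frontier_of_connected_component_subset)
    then show ?thesis using openU[of S] by (auto simp: AU frontier_def interior_open)
  qed
  have G_mono: "G S \<subseteq> G T" if "0 \<le> S" "S \<le> T" for S T
    unfolding G_def by (rule connected_component_mono[OF U_mono[OF that]])
  \<comment> \<open>A path in \<open>G S\<close> from 0 to a far point would be a compact connected
    set on which one iterate stays below \<open>m^n(S)\<close>, against
    \<open>cross\<close>.\<close>
  have boundedG: "bounded (G S)" if S: "S0 \<le> S" for S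
  proof -
    obtain \<rho> where \<rho>: "\<And>K n. \<lbrakk>connected K; 0 \<in> K; \<exists>w\<in>K. \<rho> \<le> norm w\<rbrakk>
        \<Longrightarrow> \<exists>z\<in>K. (m ^^ n) S \<le> norm ((f ^^ n) z)"
      using cross[OF S] by blast
    have "norm w < \<rho>" if w: "w \<in> G S" for w
    proof (rule ccontr)
      assume "\<not> norm w < \<rho>"
      have "path_connected (G S)"
        using openG connG by (simp add: connected_open_path_connected)
      moreover have "0 \<in> G S" using ballG[of S] S \<open>0 < S0\<close> by auto
      ultimately obtain p where p: "path p" "path_image p \<subseteq> G S" "pathstart p = 0" "pathfinish p = w"
        using w by (meson path_connected_def)
      then obtain n where n: "\<And>z. z \<in> path_image p \<Longrightarrow> norm ((f ^^ n) z) < (m ^^ n) S"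
        using compactU[of "path_image p" S] GU[of S] by (meson compact_path_image order.trans)
      moreover have "0 \<in> path_image p" "w \<in> path_image p"
        using p pathstart_in_path_image pathfinish_in_path_image by metis+
      ultimately show False
        using \<rho>[of "path_image p" n] p \<open>\<not> norm w < \<rho>\<close> connected_path_image
        by (meson not_less)
    qed
    then show ?thesis by (meson bounded_iff less_imp_le)
  qed
  \<comment> \<open>By the maximum principle \<open>G S\<close> contains what a closed path in it
    encloses; points off \<open>G S\<close> are thus outside and have winding number 0.\<close>
  have scG: "simply_connected (G S)" for S
    unfolding simply_connected_eq_winding_number_zero[OF openG]
  proof (intro conjI connG allI impI, elim conjE)
    fix p z assume p: "path p" "path_image p \<subseteq> G S" "pathfinish p = pathstart p" "z \<notin> G S"
    let ?K = "path_image p"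
    have cl: "closed ?K" "bounded ?K" "connected ?K"
      using p(1) by (auto simp: closed_path_image bounded_path_image connected_path_image)
    have "inside ?K \<subseteq> U S"
      by (rule max_principle)
         (use cl p(2) GU[of S] frontier_inside_subset[of ?K] in \<open>auto intro: open_inside bounded_inside\<close>)
    then have "?K \<union> inside ?K \<subseteq> U S" using p(2) GU by blast
    moreover have "connected (?K \<union> inside ?K)" using cl connected_with_inside by blast
    moreover obtain y where "y \<in> ?K" "y \<in> G S"
      using p(2) pathstart_in_path_image by blast
    ultimately have "?K \<union> inside ?K \<subseteq> G S"
      unfolding G_def
      using connected_component_maximal[of y "?K \<union> inside ?K" "U S"] connected_component_eq[of y "U S" 0]
      by simp
    then have "z \<in> outside ?K"
      using p(4) inside_Un_outside by blast
    then show "winding_number p z = 0"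
      using winding_number_zero_in_outside p by blast
  qed
  \<comment> \<open>Levels above \<open>R\<close> put the frontiers into \<open>A R\<close>, levels
    above \<open>S0\<close> keep the domains bounded, and the summand \<open>n\<close> makes them
    exhaust the plane.\<close>
  define s where "s n = max R S0 + real n" for n
  have s: "R \<le> s n" "S0 \<le> s n" "0 < s n" "s n \<le> s (Suc n)" for n
    using assms(5,6) by (auto simp: s_def)
  have subA: "A (s n) \<subseteq> A R" for n
    using U_mono[of R "s n"] s[of n] \<open>0 < R\<close> by (auto simp: AU)
  have exhaust: "\<exists>N. \<forall>n\<ge>N. z \<in> G (s n)" for z
  proof -
    obtain N where "norm z < real N" using reals_Archimedean2 by blast
    then have "z \<in> ball 0 (s n)" if "n \<ge> N" for n
      using that assms(5) by (auto simp: s_def)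
    then show ?thesis using ballG s by blast
  qed
  have closedA: "closed (A S)" for S by (simp add: AU openU closed_Compl)

  \<comment> \<open>Connectedness of \<open>A R\<close>\<close>
  have "connected (A R)"
  proof (rule ccontr)
    assume "\<not> connected (A R)"
    then obtain B C where BC: "closed B" "closed C" "B \<noteq> {}" "C \<noteq> {}" "B \<union> C = A R" "B \<inter> C = {}"
      using connected_closed_set[OF closedA] by metis
    have front_conn: "connected (frontier (G (s n)))" for n
      using simply_connected_eq_frontier_properties[OF openG] scG boundedG s by auto
    \<comment> \<open>Stated for arbitrary \<open>B\<close> and \<open>C\<close> because either
      piece may contain infinitely many frontiers.\<close>
    have impossible: False
      if BC: "closed B" "closed C" "B \<noteq> {}" "B \<union> C = A R" "B \<inter> C = {}"
        and inf: "\<exists>\<^sub>\<infinity>n. frontier (G (s n)) \<subseteq> C" for B C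
    proof -
      obtain z where z: "z \<in> B" using BC by blast
      obtain n where n: "z \<in> G (s n)" "frontier (G (s n)) \<subseteq> C"
        using inf exhaust[of z] by (meson INFM_nat_le)
      \<comment> \<open>The frontier lies in \<open>C\<close>, so this part of \<open>B\<close> does
        not touch it and is compact and relatively open in \<open>A R\<close>.\<close>
      let ?B = "B \<inter> closure (G (s n))"
      have sub: "?B \<subseteq> G (s n)"
        using n BC openG by (auto simp: frontier_def interior_open)
      have "closed (A R - G (s n))" using closedA openG by blast
      moreover have "A R - ?B = C \<union> (A R - G (s n))"
        using BC sub closure_subset[of "G (s n)"] by auto
      ultimately have c2: "closed (A R - ?B)" using BC by auto
      have c1: "closed ?B" using BC(1) by auto
      have c3: "?B \<inter> (A R - ?B) = {}" by blast
      obtain V W where VW: "open V" "open W" "?B \<subseteq> V" "A R - ?B \<subseteq> W" "V \<inter> W = {}"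
        by (rule separation_normal[OF c1 c2 c3])
      let ?V = "V \<inter> G (s n)"
      \<comment> \<open>\<open>H\<close> surrounds this piece: its closure misses \<open>W\<close>,
        which holds the rest of \<open>A R\<close>, so its frontier lies in
        \<open>U R\<close>.\<close>
      define H where "H = ?V"
      have H: "H = ?V" "open H" "bounded H"
        using VW openG boundedG[OF s(2)] by (auto simp: H_def intro: bounded_Int)
      have "H \<inter> W = {}" using VW(5) by (auto simp: H_def)
      then have "closure H \<inter> W = {}"
        using open_Int_closure_eq_empty[OF VW(2), of H] by (simp add: Int_commute)
      moreover have "?B \<subseteq> H" using VW(3) sub by (auto simp: H_def)
      ultimately have "frontier H \<inter> A R = {}"
        using VW(4) H(2) by (auto simp: frontier_def interior_open)
      then have "frontier H \<subseteq> U R" by (auto simp: AU)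
      then have "H \<subseteq> U R" by (rule max_principle[OF H(2,3)])
      moreover have "z \<in> H" using VW(3) z n(1) closure_subset[of "G (s n)"] by (auto simp: H_def)
      ultimately show False using z BC(4) by (auto simp: AU)
    qed
    have "frontier (G (s n)) \<subseteq> B \<or> frontier (G (s n)) \<subseteq> C" for n
    proof (rule ccontr)
      assume *: "\<not> ?thesis"
      have "frontier (G (s n)) \<subseteq> B \<union> C" using frontG subA BC by blast
      moreover have "B \<inter> frontier (G (s n)) \<noteq> {}" "C \<inter> frontier (G (s n)) \<noteq> {}"
        using * calculation by auto
      moreover have "B \<inter> C \<inter> frontier (G (s n)) = {}" using BC(6) by auto
      ultimately show False
        using front_conn[of n] BC(1,2) unfolding connected_closed by metis
    qed
    then have "(\<exists>\<^sub>\<infinity>n. frontier (G (s n)) \<subseteq> B) \<or> (\<exists>\<^sub>\<infinity>n. frontier (G (s n)) \<subseteq> C)"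
      by (simp flip: INFM_disj_distrib)
    then show False
      using impossible[OF BC(1,2,3,5,6)] impossible[OF BC(2,1,4)] BC(5,6)
      by (metis Un_commute Int_commute)
  qed
  moreover have "G (s n) \<noteq> {}" for n using exhaust ballG[OF s(3)[of n]] s(3)[of n] centre_in_ball by blast
  moreover have "frontier (G (s n)) \<subseteq> A R" for n using frontG subA by blast
  moreover have "(\<Union>n. G (s n)) = UNIV" using exhaust by blast
  moreover have "G (s n) \<subseteq> G (s (Suc n))" for n using G_mono s less_imp_le by metis
  ultimately have "spiders_web (A R)"
    unfolding spiders_web_def
    using openG connG scG boundedG[OF s(2)] by (intro conjI exI[of _ "\<lambda>n. G (s n)"]) auto
  then show ?thesis by (simp add: A_def)
qed

section \<open>Exponential sums with square frequencies\<close>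

lemma higher_deriv_exp_sum:
  fixes a e :: "nat \<Rightarrow> complex"
  shows "(deriv ^^ k) (\<lambda>w. \<Sum>n\<in>I. a n * exp (e n * w)) = (\<lambda>w. \<Sum>n\<in>I. a n * e n ^ k * exp (e n * w))"
proof (induction k)
  case (Suc k)
  have "deriv (\<lambda>w. \<Sum>n\<in>I. a n * e n ^ k * exp (e n * w)) w
      = (\<Sum>n\<in>I. a n * e n ^ Suc k * exp (e n * w))" for w
    by (rule DERIV_imp_deriv) (auto intro!: derivative_eq_intros sum.cong)
  then show ?case by (simp add: Suc)
qed simp

lemma integral_cos_nat_mult:
  "((\<lambda>x. cos (real n * x)) has_integral (if n = 0 then 2 * pi else 0)) {-pi..pi}"
proof (cases "n = 0")
  case True
  then show ?thesis using has_integral_const_real[of "1::real" "-pi" pi] by simp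
next
  case False
  have "((\<lambda>x. cos (real n * x)) has_integral (sin (real n * pi) / n - sin (real n * (-pi)) / n)) {-pi..pi}"
    by (rule fundamental_theorem_of_calculus)
       (use False in \<open>auto intro!: derivative_eq_intros simp flip: has_real_derivative_iff_has_vector_derivative\<close>)
  then show ?thesis using False by (simp add: mult.commute)
qed

lemma integral_cos_cos:
  fixes m n :: nat
  assumes "m > 0"
  shows "((\<lambda>x. cos (real n * x) * cos (real m * x)) has_integral (if n = m then pi else 0)) {-pi..pi}"
proof -
  define d where "d = (if n \<le> m then m - n else n - m)"
  have eq: "cos (real n * x) * cos (real m * x) = (cos (real d * x) + cos (real (n + m) * x)) / 2" for x
  proof -
    have "real d * x = real n * x - real m * x \<or> real d * x = - (real n * x - real m * x)"
      by (auto simp: d_def of_nat_diff algebra_simps)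
    then have "cos (real d * x) = cos (real n * x - real m * x)"
      by (metis cos_minus)
    then show ?thesis unfolding cos_times_cos by (simp add: distrib_right)
  qed
  have "((\<lambda>x. (cos (real d * x) + cos (real (n + m) * x)) / 2) has_integral
      ((if d = 0 then 2 * pi else 0) + (if n + m = 0 then 2 * pi else 0)) / 2) {-pi..pi}"
    by (intro has_integral_divide has_integral_add integral_cos_nat_mult)
  moreover have "d = 0 \<longleftrightarrow> n = m" "n + m \<noteq> 0" using assms by (auto simp: d_def)
  ultimately show ?thesis unfolding eq by (cases "n = m") (simp_all only: if_True if_False, simp_all)
qed

text \<open>The exponential sum \<open>\<phi>\<close> is the value at \<open>x = 0\<close> of \<open>u(x, w) = \<Sum>n a\<^sub>n cos (n x) exp (n\<^sup>2 w)\<close>, which solves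
  the backward heat equation; its Taylor series in \<open>x\<close> is therefore controlled by the
  \<open>w\<close>-derivatives of \<open>\<phi>\<close>, that is, by Cauchy's inequality.\<close>

lemma square_exp_sum_coeff_bound:
  fixes a :: "nat \<Rightarrow> complex"
  assumes "0 < d"
    and S: "\<And>w. norm w = d \<Longrightarrow> norm (\<Sum>n\<le>N. a n * exp (of_nat (n\<^sup>2) * w)) \<le> S"
    and m: "0 < m" "m \<le> N"
  shows "norm (a m) \<le> 2 * exp (pi\<^sup>2 / d) * S"
proof -
  define \<phi> where "\<phi> w = (\<Sum>n\<le>N. a n * exp (of_nat (n\<^sup>2) * w))" for w
  have hol: "\<phi> holomorphic_on T" and cont: "continuous_on T \<phi>" for T
    unfolding \<phi>_def by (intro holomorphic_intros continuous_intros)+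
  \<comment> \<open>As the frequencies are squares, derivatives at 0 give the even moments in the
    Taylor series of \<open>u\<close> below.\<close>
  have deriv: "(deriv ^^ k) \<phi> 0 = (\<Sum>n\<le>N. a n * of_nat n ^ (2 * k))" for k
    unfolding \<phi>_def higher_deriv_exp_sum by (simp add: power_mult)
  have cauchy: "norm (\<Sum>n\<le>N. a n * of_nat n ^ (2 * k)) \<le> fact k * S / d ^ k" for k
    unfolding deriv[symmetric]
    by (rule Cauchy_inequality)
       (use assms hol cont S[folded \<phi>_def] in auto)
  have "0 \<le> S" using order.trans[OF norm_ge_zero S[of "of_real d"]] \<open>0 < d\<close> by simp
  define u where "u x = (\<Sum>n\<le>N. a n * of_real (cos (real n * x)))" for x
  have u_bound: "norm (u x) \<le> S * exp (x\<^sup>2 / d)" for x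
  proof -
    have "(\<lambda>k. \<Sum>n\<le>N. a n * of_real ((-1) ^ k / fact (2 * k) * (real n * x) ^ (2 * k))) sums u x"
      unfolding u_def by (intro sums_sum sums_mult sums_of_real cos_paired)
    moreover have "(\<Sum>n\<le>N. a n * of_real ((-1) ^ k / fact (2 * k) * (real n * x) ^ (2 * k)))
        = of_real ((-1) ^ k / fact (2 * k) * x ^ (2 * k)) * (\<Sum>n\<le>N. a n * of_nat n ^ (2 * k))" for k
      unfolding sum_distrib_left by (intro sum.cong) (simp_all add: power_mult_distrib)
    ultimately have sums: "(\<lambda>k. of_real ((-1) ^ k / fact (2 * k) * x ^ (2 * k)) * (\<Sum>n\<le>N. a n * of_nat n ^ (2 * k))) sums u x"
      by simp
    have tbound: "norm (of_real ((-1) ^ k / fact (2 * k) * x ^ (2 * k)) * (\<Sum>n\<le>N. a n * of_nat n ^ (2 * k)))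
        \<le> S * ((x\<^sup>2 / d) ^ k /\<^sub>R fact k)" for k
    proof -
      \<comment> \<open>The factor \<open>k!\<close> of Cauchy's inequality against
        \<open>(2k)!\<close> of the cosine series leaves \<open>1/k!\<close>, which sums to an
        exponential.\<close>
      have "fact k * fact k \<le> (fact (2 * k) :: real)"
        by (metis fact_fact_dvd_fact dvd_imp_le fact_gt_zero mult_2 of_nat_fact of_nat_le_iff of_nat_mult)
      then have f: "fact k / fact (2 * k) \<le> 1 / (fact k :: real)"
        by (simp add: field_simps)
      have "norm (of_real ((-1) ^ k / fact (2 * k) * x ^ (2 * k)) * (\<Sum>n\<le>N. a n * of_nat n ^ (2 * k)))
          = x ^ (2 * k) / fact (2 * k) * norm (\<Sum>n\<le>N. a n * of_nat n ^ (2 * k))"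
        by (simp add: norm_mult norm_divide norm_power power_mult)
      also have "\<dots> \<le> x ^ (2 * k) / fact (2 * k) * (fact k * S / d ^ k)"
        by (intro mult_left_mono cauchy) (simp add: power_mult)
      also have "\<dots> = (x\<^sup>2 / d) ^ k * S * (fact k / fact (2 * k))"
        unfolding power_mult[of x 2 k] by (simp add: power_divide mult_ac)
      also have "\<dots> \<le> (x\<^sup>2 / d) ^ k * S * (1 / fact k)"
        by (intro mult_left_mono f) (use \<open>0 \<le> S\<close> \<open>0 < d\<close> in simp)
      finally show ?thesis by (simp add: field_simps)
    qed
    have es: "(\<lambda>k. S * ((x\<^sup>2 / d) ^ k /\<^sub>R fact k)) sums (S * exp (x\<^sup>2 / d))"
      by (intro sums_mult exp_converges)
    have "norm (u x) \<le> (\<Sum>k. S * ((x\<^sup>2 / d) ^ k /\<^sub>R fact k))"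
      unfolding sums_unique[OF sums]
      by (rule norm_suminf_le[OF tbound]) (use es sums_summable in blast)
    then show ?thesis using es by (simp add: sums_iff)
  qed
  \<comment> \<open>Orthogonality isolates \<open>pi * a m\<close>; the interval has length
    \<open>2 pi\<close>, hence the factor 2.\<close>
  have I: "((\<lambda>x. u x * of_real (cos (real m * x))) has_integral (of_real pi * a m)) {-pi..pi}"
  proof -
    have "((\<lambda>x. \<Sum>n\<le>N. a n * of_real (cos (real n * x) * cos (real m * x))) has_integral
        (\<Sum>n\<le>N. a n * of_real (if n = m then pi else 0))) {-pi..pi}"
      by (intro has_integral_sum has_integral_mult_right has_integral_of_real integral_cos_cos) (use m in auto)
    moreover have "(\<Sum>n\<le>N. a n * of_real (if n = m then pi else 0)) = of_real pi * a m"
      using m by (simp add: if_distrib[of of_real] if_distrib[of "\<lambda>y. _ * y"] sum.delta mult.commute cong: if_cong)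
    ultimately show ?thesis by (simp add: u_def sum_distrib_right mult.assoc)
  qed
  have "norm (of_real pi * a m) \<le> S * exp (pi\<^sup>2 / d) * measure lborel {-pi..pi}"
  proof (rule has_integral_bound_real[OF _ finite.emptyI I])
    show "0 \<le> S * exp (pi\<^sup>2 / d)" using \<open>0 \<le> S\<close> by simp
    fix x :: real assume "x \<in> {-pi..pi} - {}"
    then have "\<bar>x\<bar> \<le> pi" by auto
    then have "x\<^sup>2 \<le> pi\<^sup>2" by (meson abs_le_square_iff abs_of_pos pi_gt_zero power2_le_iff_abs_le order.trans pi_ge_zero)
    then have "exp (x\<^sup>2 / d) \<le> exp (pi\<^sup>2 / d)" using \<open>0 < d\<close> by (simp add: divide_right_mono)
    then have "norm (u x) \<le> S * exp (pi\<^sup>2 / d)"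
      using u_bound[of x] \<open>0 \<le> S\<close> by (meson mult_left_mono order.trans)
    moreover have "norm (u x * of_real (cos (real m * x))) \<le> norm (u x) * 1"
      unfolding norm_mult by (intro mult_left_mono) auto
    ultimately show "norm (u x * of_real (cos (real m * x))) \<le> S * exp (pi\<^sup>2 / d)" by simp
  qed
  then have "pi * norm (a m) \<le> pi * (2 * exp (pi\<^sup>2 / d) * S)"
    by (simp add: norm_mult algebra_simps)
  then show ?thesis by simp
qed

section \<open>Interpolation on connected sets\<close>

text \<open>Lagrange interpolation at \<open>n + 1\<close> nodes: by the separation the denominators
  of the basis polynomials are at least \<open>h^n j! (n - j)!\<close> in modulus, and the
  reciprocals of these factorials sum to \<open>2^n / n!\<close>.\<close>

lemma interpolation_bound:
  fixes p :: "complex poly" and \<zeta> :: "nat \<Rightarrow> complex"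
  assumes deg: "degree p \<le> n"
    and sep: "\<And>i j. i \<le> n \<Longrightarrow> j \<le> n \<Longrightarrow> \<bar>real i - real j\<bar> * h \<le> norm (\<zeta> i - \<zeta> j)" and "0 < h"
    and B: "\<And>i. i \<le> n \<Longrightarrow> norm (poly p (\<zeta> i)) \<le> B"
    and D: "\<And>i. i \<le> n \<Longrightarrow> norm (z - \<zeta> i) \<le> D"
  shows "norm (poly p z) \<le> B * (2 * D / h) ^ n / fact n"
proof -
  define l where "l j = (\<Prod>i\<in>{..n}-{j}. smult (1 / (\<zeta> j - \<zeta> i)) [:- \<zeta> i, 1:])" for j
  have inj: "\<zeta> i \<noteq> \<zeta> j" if "i \<le> n" "j \<le> n" "i \<noteq> j" for i j
    using sep[OF that(1,2)] that(3) \<open>0 < h\<close> by (auto simp: mult_le_0_iff)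
  have "0 \<le> B" "0 \<le> D" using B[of 0] D[of 0] norm_ge_zero order.trans by blast+
  have deg_l: "degree (l j) \<le> n" if "j \<le> n" for j
  proof -
    have "degree (l j) \<le> sum (degree \<circ> (\<lambda>i. smult (1 / (\<zeta> j - \<zeta> i)) [:- \<zeta> i, 1:])) ({..n}-{j})"
      unfolding l_def by (rule degree_prod_sum_le) simp
    also have "\<dots> \<le> sum (\<lambda>_. 1) ({..n}-{j})"
      by (intro sum_mono) (auto simp: degree_smult_le)
    also have "\<dots> = n" using that by simp
    finally show ?thesis .
  qed
  have poly_l: "poly (l j) z = (\<Prod>i\<in>{..n}-{j}. (z - \<zeta> i) / (\<zeta> j - \<zeta> i))" for j z
    unfolding l_def poly_prod by (intro prod.cong) (auto simp: diff_divide_distrib add_divide_distrib)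
  have l_at: "poly (l j) (\<zeta> i) = (if i = j then 1 else 0)" if "i \<le> n" "j \<le> n" for i j
    unfolding poly_l using inj that by (auto intro!: prod.neutral prod_zero)
  have "p = (\<Sum>j\<le>n. smult (poly p (\<zeta> j)) (l j))"
  proof (rule poly_eqI_degree)
    fix x assume "x \<in> \<zeta> ` {..n}"
    then obtain i where i: "i \<le> n" "x = \<zeta> i" by auto
    have "poly (\<Sum>j\<le>n. smult (poly p (\<zeta> j)) (l j)) x = (\<Sum>j\<le>n. if j = i then poly p (\<zeta> j) else 0)"
      unfolding poly_sum i(2) by (intro sum.cong) (use i l_at in auto)
    then show "poly p x = poly (\<Sum>j\<le>n. smult (poly p (\<zeta> j)) (l j)) x" using i by simp
  next
    have "card (\<zeta> ` {..n}) = Suc n"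
      by (subst card_image) (auto simp: inj_on_def dest: inj)
    moreover have "degree (\<Sum>j\<le>n. smult (poly p (\<zeta> j)) (l j)) \<le> n"
      by (intro degree_sum_le) (auto intro: order.trans[OF degree_smult_le] deg_l)
    ultimately show "degree p < card (\<zeta> ` {..n})" "degree (\<Sum>j\<le>n. smult (poly p (\<zeta> j)) (l j)) < card (\<zeta> ` {..n})"
      using deg by auto
  qed
  then have "norm (poly p z) = norm (\<Sum>j\<le>n. poly p (\<zeta> j) * poly (l j) z)"
    by (metis (no_types, lifting) poly_smult poly_sum sum.cong)
  also have "\<dots> \<le> (\<Sum>j\<le>n. B * ((D / h) ^ n * (1 / (fact j * fact (n - j)))))"
  proof (rule sum_norm_le)
    fix j assume j: "j \<in> {..n}"
    have prod_abs: "(\<Prod>i\<in>{..n}-{j}. \<bar>real j - real i\<bar>) = fact j * fact (n - j)"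
    proof -
      have "{..n} - {j} = {..<j} \<union> {j<..n}" using j by auto
      then have "(\<Prod>i\<in>{..n}-{j}. \<bar>real j - real i\<bar>) = (\<Prod>i<j. \<bar>real j - real i\<bar>) * (\<Prod>i\<in>{j<..n}. \<bar>real j - real i\<bar>)"
        by (simp add: prod.union_disjoint disjoint_iff)
      also have "(\<Prod>i<j. \<bar>real j - real i\<bar>) = (\<Prod>i\<in>{1..j}. real i)"
        by (rule prod.reindex_bij_witness[of _ "\<lambda>i. j - i" "\<lambda>i. j - i"]) auto
      also have "(\<Prod>i\<in>{j<..n}. \<bar>real j - real i\<bar>) = (\<Prod>i\<in>{1..n-j}. real i)"
        by (rule prod.reindex_bij_witness[of _ "\<lambda>i. i + j" "\<lambda>i. i - j"]) auto
      finally show ?thesis by (simp add: fact_prod)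
    qed
    have "norm (poly (l j) z) = (\<Prod>i\<in>{..n}-{j}. norm (z - \<zeta> i) / norm (\<zeta> j - \<zeta> i))"
      unfolding poly_l by (simp add: prod_norm[symmetric] norm_divide)
    also have "\<dots> \<le> (\<Prod>i\<in>{..n}-{j}. D / h * (1 / \<bar>real j - real i\<bar>))"
    proof (intro prod_mono conjI)
      fix i assume i: "i \<in> {..n}-{j}"
      have "0 < \<bar>real j - real i\<bar> * h" using i \<open>0 < h\<close> by simp
      then have "norm (z - \<zeta> i) / norm (\<zeta> j - \<zeta> i) \<le> D / (\<bar>real j - real i\<bar> * h)"
        using i j D sep \<open>0 \<le> D\<close> by (intro frac_le) auto
      then show "norm (z - \<zeta> i) / norm (\<zeta> j - \<zeta> i) \<le> D / h * (1 / \<bar>real j - real i\<bar>)"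
        by (simp add: field_simps)
    qed auto
    also have "\<dots> = (D / h) ^ n * (1 / (fact j * fact (n - j)))"
      unfolding prod.distrib using j prod_abs by (simp add: prod_dividef)
    finally show "norm (poly p (\<zeta> j) * poly (l j) z) \<le> B * ((D / h) ^ n * (1 / (fact j * fact (n - j))))"
      unfolding norm_mult using B j \<open>0 \<le> B\<close> by (intro mult_mono) auto
  qed
  also have "\<dots> = B * (D / h) ^ n / fact n * (\<Sum>j\<le>n. real (n choose j))"
    unfolding sum_distrib_left by (intro sum.cong) (auto simp: binomial_fact field_simps)
  also have "(\<Sum>j\<le>n. real (n choose j)) = 2 ^ n"
    by (metis choose_row_sum of_nat_sum of_nat_power of_nat_numeral)
  finally show ?thesis by (simp add: power_mult_distrib power_divide field_simps)
qed

lemma power_self_le_fact_exp: "real n ^ n \<le> fact n * exp (real n)"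
proof -
  have "real n ^ n /\<^sub>R fact n \<le> (\<Sum>k. real n ^ k /\<^sub>R fact k)"
    using sum_le_suminf[OF summable_exp_generic[of "real n"], of "{n}"] by simp
  then have "real n ^ n /\<^sub>R fact n \<le> exp (real n)" by (simp add: exp_def)
  then show ?thesis by (simp add: field_simps)
qed

text \<open>Interpolating the Taylor polynomial of degree \<open>n\<close> in points of \<open>K\<close>, and using the large
  disc to make the Taylor remainder small, gives a two-constants estimate that does not need
  harmonic measure.\<close>

lemma two_constants_on_connected:
  fixes h :: "complex \<Rightarrow> complex"
  assumes hol: "h holomorphic_on UNIV" and "0 < s" "0 < n"
    and M: "\<And>z. norm (z - z0) \<le> 48 * s \<Longrightarrow> norm (h z) \<le> M"
    and K: "connected K" "z0 \<in> K" "w \<in> K" "s \<le> norm (w - z0)"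
    and B: "\<And>z. z \<in> K \<Longrightarrow> norm (h z) \<le> B"
    and z1: "norm (z1 - z0) \<le> s"
  shows "norm (h z1) \<le> 12 ^ n * B + 2 * M / 4 ^ n"
proof -
  define c where "c k = (deriv ^^ k) h z0 / fact k" for k
  define p where "p = (\<Sum>k\<le>n. smult (c k) ([:- z0, 1:] ^ k))"
  have cont: "continuous_on T h" for T
    using hol holomorphic_on_imp_continuous_on continuous_on_subset by blast
  have c_bound: "norm (c k) \<le> M / (48 * s) ^ k" for k
  proof -
    have "norm ((deriv ^^ k) h z0) \<le> fact k * M / (48 * s) ^ k"
      by (rule Cauchy_inequality)
         (use \<open>0 < s\<close> M cont holomorphic_on_subset[OF hol] in \<open>auto simp: norm_minus_commute\<close>)
    then show ?thesis by (simp add: c_def norm_divide field_simps)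
  qed
  have poly_p: "poly p z = (\<Sum>k\<le>n. c k * (z - z0) ^ k)" for z
    by (simp add: p_def poly_sum)
  \<comment> \<open>At distance at most \<open>s\<close>, against the radius \<open>48 s\<close> in
    Cauchy's inequality, the Taylor remainder is dominated by a geometric tail of ratio
    1/48.\<close>
  have rem: "norm (h z - poly p z) \<le> M / 48 ^ n" if z: "norm (z - z0) \<le> s" for z
  proof -
    have "(\<lambda>k. c k * (z - z0) ^ k) sums h z"
      unfolding c_def
      by (rule holomorphic_power_series[of _ _ "2 * s"])
         (use holomorphic_on_subset[OF hol] z \<open>0 < s\<close> in \<open>auto simp: dist_norm norm_minus_commute\<close>)
    from sums_split_initial_segment[OF this, of "Suc n"]
    have sums: "(\<lambda>k. c (k + Suc n) * (z - z0) ^ (k + Suc n)) sums (h z - poly p z)"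
      by (simp add: poly_p lessThan_Suc_atMost)
    have geo: "(\<lambda>k. M / 48 ^ Suc n * (1 / 48) ^ k) sums (M / 48 ^ Suc n * (1 / (1 - 1 / 48)))"
      by (intro sums_mult geometric_sums) simp
    have "0 \<le> M" using M[of z0] \<open>0 < s\<close> order.trans[OF norm_ge_zero] by auto
    have "norm (c (k + Suc n) * (z - z0) ^ (k + Suc n)) \<le> M / 48 ^ Suc n * (1 / 48) ^ k" for k
    proof -
      have "norm (c (k + Suc n) * (z - z0) ^ (k + Suc n)) \<le> M / (48 * s) ^ (k + Suc n) * s ^ (k + Suc n)"
        unfolding norm_mult norm_power
        by (intro mult_mono c_bound power_mono z) (use \<open>0 \<le> M\<close> \<open>0 < s\<close> in auto)
      also have "\<dots> = M / 48 ^ Suc n * (1 / 48) ^ k"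
        using \<open>0 < s\<close> by (simp add: power_mult_distrib power_add power_divide)
      finally show ?thesis .
    qed
    then have "norm (h z - poly p z) \<le> (\<Sum>k. M / 48 ^ Suc n * (1 / 48) ^ k)"
      unfolding sums_unique[OF sums] by (rule norm_suminf_le) (use geo sums_summable in blast)
    also have "\<dots> = M / 48 ^ n * (1 / 47)" using sums_unique[OF geo] by simp
    also have "\<dots> \<le> M / 48 ^ n" using \<open>0 \<le> M\<close> by (simp add: divide_simps)
    finally show ?thesis .
  qed
  \<comment> \<open>The distance to \<open>z0\<close> takes all values from 0 to \<open>s\<close> on
    the connected set \<open>K\<close>; nodes at equally spaced distances are separated as
    interpolation requires.\<close>
  have "\<exists>\<zeta>\<in>K. norm (\<zeta> - z0) = real j * (s / n)" if "j \<le> n" for j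
  proof -
    have "connected ((\<lambda>z. norm (z - z0)) ` K)"
      by (intro connected_continuous_image continuous_intros K)
    then have "{0..norm (w - z0)} \<subseteq> (\<lambda>z. norm (z - z0)) ` K"
      by (rule connected_contains_Icc) (use K in \<open>force+\<close>)
    moreover have "real j * (s / n) \<le> s"
      using that \<open>0 < n\<close> \<open>0 < s\<close> by (simp add: field_simps)
    then have "real j * (s / n) \<in> {0..norm (w - z0)}"
      using K(4) \<open>0 < s\<close> by auto
    ultimately show ?thesis by (metis (no_types, lifting) imageE subsetD)
  qed
  then obtain \<zeta> where \<zeta>: "\<And>j. j \<le> n \<Longrightarrow> \<zeta> j \<in> K" "\<And>j. j \<le> n \<Longrightarrow> norm (\<zeta> j - z0) = real j * (s / n)"
    by metis
  have \<zeta>_near: "norm (\<zeta> j - z0) \<le> s" if "j \<le> n" for j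
    unfolding \<zeta>(2)[OF that] using that \<open>0 < n\<close> \<open>0 < s\<close> by (simp add: field_simps)
  have P: "norm (poly p z1) \<le> (B + M / 48 ^ n) * (2 * (2 * s) / (s / n)) ^ n / fact n"
  proof (rule interpolation_bound)
    show "degree p \<le> n"
      unfolding p_def
      by (intro degree_sum_le) (auto intro!: order.trans[OF degree_smult_le] order.trans[OF degree_power_le])
    show "\<bar>real i - real j\<bar> * (s / n) \<le> norm (\<zeta> i - \<zeta> j)" if "i \<le> n" "j \<le> n" for i j
    proof -
      have "\<bar>real i - real j\<bar> * (s / n) = \<bar>norm (\<zeta> i - z0) - norm (\<zeta> j - z0)\<bar>"
        unfolding \<zeta>(2)[OF that(1)] \<zeta>(2)[OF that(2)] left_diff_distrib[symmetric] abs_mult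
        using \<open>0 < s\<close> by simp
      also have "\<dots> \<le> norm (\<zeta> i - \<zeta> j)"
        using norm_triangle_ineq3[of "\<zeta> i - z0" "\<zeta> j - z0"] by simp
      finally show ?thesis .
    qed
    show "norm (poly p (\<zeta> i)) \<le> B + M / 48 ^ n" if "i \<le> n" for i
      using B[OF \<zeta>(1)[OF that]] rem[OF \<zeta>_near[OF that]] norm_triangle_ineq2[of "poly p (\<zeta> i)" "h (\<zeta> i)"]
      by (simp add: norm_minus_commute)
    show "norm (z1 - \<zeta> i) \<le> 2 * s" if "i \<le> n" for i
      using z1 \<zeta>_near[OF that] norm_triangle_ineq4[of "z1 - z0" "\<zeta> i - z0"] by simp
  qed (use \<open>0 < s\<close> \<open>0 < n\<close> in auto)
  \<comment> \<open>Interpolation costs at most \<open>(4 e)^n <= 12^n\<close>; against the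
    remainder \<open>48^-n\<close> this leaves \<open>4^-n\<close>, hence the radius
    \<open>48 s\<close> of the large disc.\<close>
  have "(2 * (2 * s) / (s / n)) ^ n / fact n = 4 ^ n * (real n ^ n / fact n)"
    using \<open>0 < s\<close> by (simp add: power_mult_distrib)
  also have "\<dots> \<le> 4 ^ n * 3 ^ n"
  proof (intro mult_left_mono)
    have "real n ^ n / fact n \<le> exp (real n)"
      using power_self_le_fact_exp[of n] by (simp add: field_simps)
    also have "exp (real n) \<le> 3 ^ n"
      using power_mono[OF exp_le, of n] by (simp flip: exp_of_nat_mult)
    finally show "real n ^ n / fact n \<le> 3 ^ n" .
  qed simp
  finally have F: "(2 * (2 * s) / (s / n)) ^ n / fact n \<le> 12 ^ n"
    by (simp flip: power_mult_distrib)
  have "0 \<le> B" "0 \<le> M"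
    using B[OF K(2)] M[of z0] \<open>0 < s\<close> order.trans[OF norm_ge_zero] by auto
  then have "norm (poly p z1) \<le> (B + M / 48 ^ n) * 12 ^ n"
    using P F mult_left_mono[OF F, of "B + M / 48 ^ n"] by simp
  also have "\<dots> = 12 ^ n * B + M / 4 ^ n"
    using power_mult_distrib[of "12::real" 4 n] by (simp add: field_simps)
  finally have "norm (h z1) \<le> 12 ^ n * B + M / 4 ^ n + M / 48 ^ n"
    using rem[OF z1] norm_triangle_ineq2[of "h z1" "poly p z1"] by simp
  moreover have "M / 48 ^ n \<le> M / 4 ^ n"
    using \<open>0 \<le> M\<close> by (intro divide_left_mono power_mono) auto
  ultimately show ?thesis by simp
qed

section \<open>Power series with square exponents\<close>

locale square_gap_series =
  fixes a :: "nat \<Rightarrow> real"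
  assumes nonneg: "0 \<le> a n" and a1: "0 < a 1"
    and summable: "summable (\<lambda>n. a n * r ^ (n\<^sup>2))"
    and upper: "0 \<le> r \<Longrightarrow> (\<Sum>n. a n * r ^ (n\<^sup>2)) \<le> exp (exp r)"
    and lower: "48 \<le> r \<Longrightarrow> exp (exp (r / 48)) \<le> (\<Sum>n. a n * r ^ (n\<^sup>2))"
begin

section \<open>The series \<open>g\<close>, its majorant \<open>G\<close>, and the maximum
  modulus\<close>

definition G :: "real \<Rightarrow> real" where "G r = (\<Sum>n. a n * r ^ (n\<^sup>2))"

definition g :: "complex \<Rightarrow> complex" where "g z = (\<Sum>n. of_real (a n) * z ^ (n\<^sup>2))"

text \<open>The Taylor coefficients of \<open>g\<close>: the sum has one term if \<open>k\<close> is
  a square and none otherwise. In this form termwise differentiation applies.\<close>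

definition c :: "nat \<Rightarrow> real" where "c k = (\<Sum>n | n\<^sup>2 = k. a n)"

lemma c_nonneg: "0 \<le> c k"
  unfolding c_def by (intro sum_nonneg nonneg)

lemma sums_c_iff:
  fixes z :: "'a :: real_normed_field"
  shows "(\<lambda>k. of_real (c k) * z ^ k) sums s \<longleftrightarrow> (\<lambda>n. of_real (a n) * z ^ (n\<^sup>2)) sums s"
proof -
  have "c (n\<^sup>2) = a n" for n
    by (simp add: c_def)
  moreover have "c k = 0" if "k \<notin> range power2" for k
  proof -
    have "{n. n\<^sup>2 = k} = {}" using that by auto
    then show ?thesis by (simp add: c_def)
  qed
  ultimately show ?thesis
    using sums_mono_reindex[of "power2 :: nat \<Rightarrow> nat" "\<lambda>k. of_real (c k) * z ^ k" s]
    by (simp add: strict_mono_def power_strict_mono)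
qed

lemma G_sums: "(\<lambda>n. a n * r ^ (n\<^sup>2)) sums G r"
  unfolding G_def using summable by (rule summable_sums)

lemma G_sums_c: "(\<lambda>k. c k * r ^ k) sums G r"
  using sums_c_iff[of r "G r"] G_sums by simp

lemma summable_norm_g: "summable (\<lambda>n. norm (of_real (a n) * z ^ (n\<^sup>2)))" for z :: complex
  using summable[of "norm z"] by (simp add: norm_mult norm_power nonneg)

lemma g_sums: "(\<lambda>n. of_real (a n) * z ^ (n\<^sup>2)) sums g z"
  unfolding g_def using summable_norm_cancel[OF summable_norm_g] by (rule summable_sums)

lemma holomorphic_g: "g holomorphic_on S"
proof -
  have "g holomorphic_on ball 0 r" for r
    by (rule power_series_holomorphic[of _ _ "\<lambda>k. of_real (c k)"]) (use sums_c_iff g_sums in auto)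
  then have "g field_differentiable at z" for z
    by (metis centre_in_ball dist_norm diff_zero holomorphic_on_imp_differentiable_at less_add_one
        mem_ball norm_minus_commute open_ball)
  then show ?thesis
    by (simp add: holomorphic_on_def field_differentiable_at_within)
qed

lemma continuous_g: "continuous_on S g"
  using holomorphic_g holomorphic_on_imp_continuous_on by blast

lemma norm_g_le: "norm (g z) \<le> G (norm z)"
  unfolding g_def G_def using summable_norm[OF summable_norm_g, of z]
  by (simp add: norm_mult norm_power nonneg)

lemma g_of_real: "g (of_real r) = of_real (G r)"
proof -
  have "(\<lambda>n. of_real (a n * r ^ (n\<^sup>2)) :: complex) sums of_real (G r)"
    by (intro sums_of_real G_sums)
  then show ?thesis using g_sums[of "of_real r"] by (simp add: sums_unique2)
qed

text \<open>Every term of the series increases on the nonnegative half-line, and the linear term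
  alone contributes the stated amount; strict monotonicity follows.\<close>

lemma G_add:
  assumes "0 \<le> x" "x \<le> y" shows "G x + a 1 * (y - x) \<le> G y"
proof -
  have "(\<lambda>n. a n * y ^ (n\<^sup>2) - a n * x ^ (n\<^sup>2)) sums (G y - G x)"
    by (intro sums_diff G_sums)
  moreover have "0 \<le> a n * y ^ (n\<^sup>2) - a n * x ^ (n\<^sup>2)" for n
    using assms by (simp add: mult_left_mono nonneg power_mono)
  ultimately have "(\<Sum>n\<in>{1}. a n * y ^ (n\<^sup>2) - a n * x ^ (n\<^sup>2)) \<le> G y - G x"
    using sum_le_suminf[of "\<lambda>n. a n * y ^ (n\<^sup>2) - a n * x ^ (n\<^sup>2)" "{1}"] by (simp add: sums_iff)
  then show ?thesis by (simp add: algebra_simps)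
qed

lemma G_mono: "0 \<le> x \<Longrightarrow> x \<le> y \<Longrightarrow> G x \<le> G y"
  using G_add[of x y] mult_nonneg_nonneg[OF less_imp_le[OF a1], of "y - x"] by linarith

lemma G_strict_mono: "0 \<le> x \<Longrightarrow> x < y \<Longrightarrow> G x < G y"
  using G_add[of x y] mult_pos_pos[OF a1, of "y - x"] by linarith

lemma G_nonneg: "0 \<le> r \<Longrightarrow> 0 \<le> G r"
  unfolding G_def by (intro suminf_nonneg summable) (simp add: nonneg)

lemma G_pos: "0 < r \<Longrightarrow> 0 < G r"
  using G_strict_mono[of 0 r] G_nonneg[of 0] by simp

lemma G_upper: "0 \<le> r \<Longrightarrow> G r \<le> exp (exp r)"
  unfolding G_def by (rule upper)

lemma G_lower: "48 \<le> r \<Longrightarrow> exp (exp (r / 48)) \<le> G r"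
  unfolding G_def by (rule lower)

lemma ln_G_upper: "0 < r \<Longrightarrow> ln (G r) \<le> exp r"
  using ln_mono[OF G_upper G_pos, of r] by simp

lemma ln_G_lower: "48 \<le> r \<Longrightarrow> exp (r / 48) \<le> ln (G r)"
  using G_lower[of r] G_pos[of r] by (simp add: ln_ge_iff)

text \<open>As the coefficients are nonnegative, the majorant \<open>G\<close> of \<open>|g|\<close>
  is attained at the real point \<open>r\<close> of the circle.\<close>

lemma max_modulus_g: "0 \<le> r \<Longrightarrow> max_modulus r g = G r"
  unfolding max_modulus_def
proof (rule cSup_eq_maximum)
  assume "0 \<le> r"
  then have "G r = norm (g (of_real r))" "(of_real r :: complex) \<in> sphere 0 r"
    by (auto simp: g_of_real G_nonneg)
  then show "G r \<in> (\<lambda>z. norm (g z)) ` sphere 0 r" by blast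
qed (use norm_g_le in auto)

section \<open>Transcendence and infinite order\<close>

lemma transcendental_g: "transcendental_entire g"
proof -
  have False if p: "\<And>z. g z = poly p z" for p
  proof -
    define C where "C = (\<Sum>i\<le>degree p. norm (coeff p i))"
    have "G r \<le> C * r ^ degree p" if "1 \<le> r" for r
    proof -
      have "G r = norm (poly p (of_real r))"
        using p[of "of_real r"] g_of_real[of r] G_nonneg[of r] that by (metis abs_of_nonneg norm_of_real order.trans zero_le_one)
      also have "\<dots> \<le> (\<Sum>i\<le>degree p. norm (coeff p i) * r ^ degree p)"
        unfolding poly_altdef
      proof (rule sum_norm_le)
        fix i assume "i \<in> {..degree p}"
        then show "norm (coeff p i * of_real r ^ i) \<le> norm (coeff p i) * r ^ degree p"
          using that by (auto simp: norm_mult norm_power intro!: mult_left_mono power_increasing)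
      qed
      finally show ?thesis by (simp add: C_def sum_distrib_right)
    qed
    then have "\<forall>\<^sub>F r in at_top. exp (exp (r / 48)) \<le> C * r ^ degree p"
      by (intro eventually_at_top_linorderI[of 48] order.trans[OF G_lower]) auto
    moreover have "\<forall>\<^sub>F r in at_top. C * (r ^ degree p / exp r) < 1"
    proof (rule order_tendstoD(2))
      show "((\<lambda>r. C * (r ^ degree p / exp r)) \<longlongrightarrow> C * 0) at_top"
        by (intro tendsto_mult_left tendsto_power_div_exp_0)
    qed simp
    moreover have "\<forall>\<^sub>F r :: real in at_top. exp r \<le> exp (exp (r / 48))"
      by real_asymp
    ultimately have "\<forall>\<^sub>F r :: real in at_top. False"
      by eventually_elim (simp add: field_simps)
    then show False by simp
  qed
  then show ?thesis using holomorphic_g by (auto simp: transcendental_entire_def)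
qed

lemma growth_order_g: "growth_order g = \<infinity>"
proof -
  have "filterlim (\<lambda>r. ln (ln (max_modulus r g)) / ln r) at_top at_top"
  proof (rule filterlim_at_top_mono)
    show "filterlim (\<lambda>r::real. r / 48 / ln r) at_top at_top" by real_asymp
    show "\<forall>\<^sub>F r in at_top. r / 48 / ln r \<le> ln (ln (max_modulus r g)) / ln r"
    proof (rule eventually_at_top_linorderI[of 48])
      fix r :: real assume r: "48 \<le> r"
      have "r / 48 \<le> ln (ln (G r))"
        using ln_mono[OF ln_G_lower[OF r]] by simp
      then have "r / 48 / ln r \<le> ln (ln (G r)) / ln r"
        by (rule divide_right_mono) (use r in auto)
      then show "r / 48 / ln r \<le> ln (ln (max_modulus r g)) / ln r"
        using r by (simp add: max_modulus_g)
    qed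
  qed
  then have "((\<lambda>r. ereal (ln (ln (max_modulus r g)) / ln r)) \<longlongrightarrow> \<infinity>) at_top"
    by (simp add: tendsto_PInfty_eq_at_top)
  then show ?thesis unfolding growth_order_def by (intro lim_imp_Limsup) auto
qed

section \<open>Convexity and log-regularity\<close>

lemma summable_c: "summable (\<lambda>k. c k * x ^ k)"
  using G_sums_c sums_summable by blast

lemma G_has_derivative:
  obtains G' where "\<And>r. (G has_real_derivative G' r) (at r)"
    and "\<And>r. (\<lambda>k. real k * c k * r ^ k) sums (r * G' r)"
proof
  show "(G has_real_derivative (\<Sum>k. diffs c k * r ^ k)) (at r)" for r
    using termdiffs_strong_converges_everywhere[OF summable_c, of r] G_sums_c
    by (simp add: sums_iff)
  show "(\<lambda>k. real k * c k * r ^ k) sums (r * (\<Sum>k. diffs c k * r ^ k))" for r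
  proof -
    have "(\<lambda>k. r * (of_nat k * c k * r ^ (k - Suc 0))) sums (r * (\<Sum>k. diffs c k * r ^ k))"
      by (intro sums_mult diffs_equiv termdiff_converges_all summable_c)
    moreover have "r * (of_nat k * c k * r ^ (k - Suc 0)) = real k * c k * r ^ k" for k
      by (cases k) auto
    ultimately show ?thesis by simp
  qed
qed

text \<open>Jensen's inequality for the probability weights \<open>c\<^sub>k r\<^sup>k / G r\<close>: this is the convexity of
  \<open>ln (G (exp t))\<close> in the form of the tangent line at \<open>t = ln r\<close>.\<close>

lemma ln_G_above_tangent:
  assumes "0 < r" and D: "(\<lambda>k. real k * c k * r ^ k) sums D"
  shows "ln (G r) + D / G r * u \<le> ln (G (r * exp u))"
proof -
  define A where "A = D / G r * u"
  have "G r > 0" using G_pos assms by simp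
  \<comment> \<open>\<open>A\<close> is the weighted mean of \<open>k u\<close>, so the deviations
    average to zero and \<open>exp x >= 1 + x\<close> can be applied termwise.\<close>
  have "exp A * G r = exp A * (G r * (1 - A) + D * u)"
    using \<open>G r > 0\<close> by (simp add: A_def field_simps)
  also have "\<dots> \<le> G (r * exp u)"
  proof (rule sums_le)
    show "(\<lambda>k. exp A * (c k * r ^ k * (1 - A) + real k * c k * r ^ k * u)) sums (exp A * (G r * (1 - A) + D * u))"
      by (intro sums_mult sums_add sums_mult2 G_sums_c D)
    show "(\<lambda>k. c k * (r * exp u) ^ k) sums G (r * exp u)" by (rule G_sums_c)
    show "exp A * (c k * r ^ k * (1 - A) + real k * c k * r ^ k * u) \<le> c k * (r * exp u) ^ k" for k
    proof -
      have "exp A * (1 + (real k * u - A)) \<le> exp A * exp (real k * u - A)"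
        by (intro mult_left_mono exp_ge_add_one_self) simp
      also have "\<dots> = exp u ^ k" by (simp add: exp_of_nat_mult flip: exp_add)
      finally have "c k * r ^ k * (exp A * (1 + (real k * u - A))) \<le> c k * r ^ k * exp u ^ k"
        using c_nonneg \<open>0 < r\<close> by (intro mult_left_mono) auto
      then show ?thesis by (simp add: algebra_simps power_mult_distrib)
    qed
  qed
  finally have "ln (exp A * G r) \<le> ln (G (r * exp u))"
    by (rule ln_mono) (use \<open>G r > 0\<close> in simp)
  then show ?thesis using \<open>G r > 0\<close> by (simp add: ln_mult A_def add.commute)
qed

text \<open>The tangent at \<open>t\<close>, evaluated at \<open>t / 2\<close>, lies below
  \<open>\<phi>(t / 2)\<close>, which for large \<open>t\<close> is at most
  \<open>\<phi>(t) / 4\<close>; hence \<open>t \<phi>'(t) >= 3/2 \<phi>(t)\<close>, and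
  \<open>c = 1/2\<close> works.\<close>

lemma log_regular_g: "log_regular g"
proof -
  have log_max: "log_max_modulus g = (\<lambda>t. ln (G (exp t)))"
    by (simp add: fun_eq_iff log_max_modulus_def max_modulus_g)
  obtain G' where G': "\<And>r. (G has_real_derivative G' r) (at r)"
    "\<And>r. (\<lambda>k. real k * c k * r ^ k) sums (r * G' r)"
    using G_has_derivative by blast
  have "\<forall>\<^sub>F t :: real in at_top. exp (exp (t / 2)) \<le> exp (exp t / 48) / 4 \<and> 48 \<le> exp t \<and> 0 < t"
    by (intro eventually_conj; real_asymp)
  then have "log_regular_with (1/2) g"
    unfolding log_regular_with_def log_max
  proof eventually_elim
    case (elim t)
    define E where "E = exp t * G' (exp t) / G (exp t)"
    have pos: "0 < G (exp t)" by (simp add: G_pos)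
    have "((\<lambda>t. ln (G (exp t))) has_real_derivative E) (at t)"
      unfolding E_def using pos
      by (auto intro!: derivative_eq_intros DERIV_chain2[OF G'(1)])
    then have "((\<lambda>t. ln (G (exp t))) has_real_derivative E) (at_right t)"
      by (rule has_field_derivative_at_within)
    moreover have "(1 + 1 / 2) / t \<le> E / ln (G (exp t))"
    proof -
      have l: "exp (exp t / 48) \<le> ln (G (exp t))" using ln_G_lower elim by simp
      then have lpos: "0 < ln (G (exp t))" using less_le_trans[OF exp_gt_zero] by blast
      have "ln (G (exp (t / 2))) \<le> exp (exp (t / 2))" by (intro ln_G_upper) simp
      with elim l have "ln (G (exp (t / 2))) \<le> ln (G (exp t)) / 4" by linarith
      moreover have "ln (G (exp t)) + E * (- t / 2) \<le> ln (G (exp (t / 2)))"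
        using ln_G_above_tangent[OF _ G'(2), of "exp t" "- t / 2"]
        by (simp add: E_def flip: exp_add)
      ultimately have "3 / 2 * ln (G (exp t)) \<le> E * t" by linarith
      then show ?thesis using lpos elim by (simp add: field_simps)
    qed
    ultimately show ?case by blast
  qed
  then show ?thesis using transcendental_g by (auto simp: log_regular_def intro!: exI[of _ "1/2"])
qed

section \<open>Lower bounds for the maximum of \<open>|g|\<close> on discs\<close>

text \<open>\<open>square_exp_sum_coeff_bound\<close> is applied to partial sums of
  \<open>g (z0 * exp w)\<close>, whose coefficients have modulus \<open>a n * r^(n^2)\<close>; then
  the truncation index tends to infinity.\<close>

lemma coefficient_le_local_sup:
  assumes z0: "norm z0 = r" and s: "0 < s" "s \<le> r" and "0 < m"
    and S: "\<And>z. norm (z - z0) \<le> s \<Longrightarrow> norm (g z) \<le> S"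
  shows "a m * r ^ (m\<^sup>2) \<le> 2 * exp (32 * r / s) * S"
proof -
  \<comment> \<open>For \<open>|w| = d\<close> the point \<open>z0 * exp w\<close> is within
    \<open>3/4 s\<close> of \<open>z0\<close>, so its modulus is at most \<open>2 r\<close>, the
    radius used for the tails.\<close>
  define d where "d = s / (2 * r)"
  have d: "0 < d" "d \<le> 1 / 2" using s by (auto simp: d_def)
  have "0 \<le> S" using S[of z0] s order.trans[OF norm_ge_zero] by auto
  define \<tau> where "\<tau> N = (\<Sum>n. a (n + Suc N) * (2 * r) ^ ((n + Suc N)\<^sup>2))" for N
  have "\<tau> \<longlonglongrightarrow> 0"
  proof -
    have "(\<lambda>N. \<Sum>n. a (n + N) * (2 * r) ^ ((n + N)\<^sup>2)) \<longlonglongrightarrow> 0"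
      by (rule suminf_exist_split2[OF summable])
    then show ?thesis unfolding \<tau>_def by (rule LIMSEQ_Suc)
  qed
  have "a m * r ^ (m\<^sup>2) \<le> 2 * exp (pi\<^sup>2 / d) * (S + \<tau> N)" if N: "m \<le> N" for N
  proof -
    have "norm (of_real (a m) * z0 ^ (m\<^sup>2)) \<le> 2 * exp (pi\<^sup>2 / d) * (S + \<tau> N)"
    proof (rule square_exp_sum_coeff_bound[OF d(1) _ \<open>0 < m\<close> N])
      fix w :: complex assume w: "norm w = d"
      define z where "z = z0 * exp w"
      have "norm (exp w - 1) \<le> 3 / 2 * d"
        using norm_exp_bounds(2)[of w] w d by simp
      then have "norm (z - z0) \<le> r * (3 / 2 * d)"
        using z0 s norm_mult[of z0 "exp w - 1"] mult_left_mono[of _ _ r] by (simp add: z_def algebra_simps)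
      also have "\<dots> \<le> s" using s by (simp add: d_def)
      finally have near: "norm (z - z0) \<le> s" .
      then have "norm z \<le> 2 * r" using z0 s norm_triangle_ineq2[of z z0] by simp
      have eq: "of_real (a n) * z0 ^ (n\<^sup>2) * exp (of_nat (n\<^sup>2) * w) = of_real (a n) * z ^ (n\<^sup>2)" for n
        by (simp only: z_def power_mult_distrib exp_of_nat_mult mult.assoc)
      define P where "P = (\<Sum>n\<le>N. of_real (a n) * z ^ (n\<^sup>2))"
      have sums: "(\<lambda>n. of_real (a (n + Suc N)) * z ^ ((n + Suc N)\<^sup>2)) sums (g z - P)"
        using sums_split_initial_segment[OF g_sums, of "Suc N" z] by (simp add: P_def lessThan_Suc_atMost)
      have "norm (g z - P) \<le> \<tau> N"
        unfolding \<tau>_def sums_unique[OF sums]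
      proof (rule norm_suminf_le)
        show "norm (of_real (a (n + Suc N)) * z ^ ((n + Suc N)\<^sup>2)) \<le> a (n + Suc N) * (2 * r) ^ ((n + Suc N)\<^sup>2)" for n
          unfolding norm_mult norm_power norm_of_real abs_of_nonneg[OF nonneg]
          by (intro mult_left_mono power_mono \<open>norm z \<le> 2 * r\<close> nonneg) auto
        show "summable (\<lambda>n. a (n + Suc N) * (2 * r) ^ ((n + Suc N)\<^sup>2))"
          using summable by (rule summable_ignore_initial_segment)
      qed
      then have "norm P \<le> S + \<tau> N"
        using S[OF near] norm_triangle_sub[of P "g z"] by (simp add: norm_minus_commute)
      then show "norm (\<Sum>n\<le>N. of_real (a n) * z0 ^ (n\<^sup>2) * exp (of_nat (n\<^sup>2) * w)) \<le> S + \<tau> N"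
        unfolding eq P_def .
    qed
    then show ?thesis using z0 by (simp add: norm_mult norm_power nonneg)
  qed
  then have bound: "\<exists>M. \<forall>N\<ge>M. a m * r ^ (m\<^sup>2) \<le> 2 * exp (pi\<^sup>2 / d) * (S + \<tau> N)" by blast
  have "(\<lambda>N. 2 * exp (pi\<^sup>2 / d) * (S + \<tau> N)) \<longlonglongrightarrow> 2 * exp (pi\<^sup>2 / d) * (S + 0)"
    by (intro tendsto_intros \<open>\<tau> \<longlonglongrightarrow> 0\<close>)
  from LIMSEQ_le_const[OF this bound] have "a m * r ^ (m\<^sup>2) \<le> 2 * exp (pi\<^sup>2 / d) * S" by simp
  also have "\<dots> \<le> 2 * exp (32 * r / s) * S"
  proof -
    have "pi\<^sup>2 \<le> 4\<^sup>2" using pi_less_4 by (intro power_mono) auto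
    then have "pi\<^sup>2 / d \<le> 32 * r / s" using s by (simp add: d_def field_simps)
    then show ?thesis using \<open>0 \<le> S\<close> by (simp add: mult_right_mono)
  qed
  finally show ?thesis .
qed

text \<open>The coefficient bounds are summed: shrinking the radius from \<open>r\<close> to
  \<open>r - s\<close> gains \<open>q^(n^2) <= q^n\<close>, and the geometric series gives
  \<open>r / s\<close>.\<close>

lemma G_le_local_sup:
  assumes z0: "norm z0 = r" and s: "0 < s" "49 + s \<le> r"
    and S: "\<And>z. norm (z - z0) \<le> s \<Longrightarrow> norm (g z) \<le> S"
  shows "G (r - s) \<le> 4 * exp (32 * r / s) * (r / s) * S"
proof -
  define C where "C = 2 * exp (32 * r / s) * S"
  define q where "q = (r - s) / r"
  have q: "0 < q" "q < 1" "1 - q = s / r" using s by (auto simp: q_def field_simps)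
  have "0 \<le> S" using S[of z0] s order.trans[OF norm_ge_zero] by auto
  then have "0 \<le> C" by (simp add: C_def)
  have "G (r - s) \<le> a 0 + C * (1 / (1 - q))"
  proof (rule sums_le[OF _ G_sums])
    show "(\<lambda>n. (if n = 0 then a 0 else 0) + C * q ^ n) sums (a 0 + C * (1 / (1 - q)))"
      by (intro sums_add sums_mult geometric_sums sums_single) (use q in auto)
    show "a n * (r - s) ^ (n\<^sup>2) \<le> (if n = 0 then a 0 else 0) + C * q ^ n" for n
    proof (cases "n = 0")
      case False
      have "a n * (r - s) ^ (n\<^sup>2) = a n * r ^ (n\<^sup>2) * q ^ (n\<^sup>2)"
        using s by (simp add: q_def power_divide)
      also have "\<dots> \<le> C * q ^ n"
      proof (intro mult_mono)
        show "a n * r ^ (n\<^sup>2) \<le> C"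
          unfolding C_def using coefficient_le_local_sup[OF z0 s(1) _ _ S] s False by simp
        show "q ^ (n\<^sup>2) \<le> q ^ n"
          using q False by (intro power_decreasing) (auto simp: power2_eq_square)
      qed (use \<open>0 \<le> C\<close> q in auto)
      finally show ?thesis using False by simp
    qed (use \<open>0 \<le> C\<close> in simp)
  qed
  \<comment> \<open>The coefficient bound covers positive indices only. The constant term is at most
    half of \<open>G (r - s)\<close> and is absorbed, which doubles the constant.\<close>
  moreover have "2 * a 0 \<le> G (r - s)"
  proof -
    have "a 0 \<le> G 0"
      unfolding G_def using sum_le_suminf[OF summable, of "{0}" 0] by (simp add: nonneg)
    also have "G 0 \<le> exp 1" using G_upper[of 0] by simp
    finally have "2 * a 0 \<le> 2 * exp 1" by simp
    also have "\<dots> \<le> exp 1 * exp (1::real)" using exp_ge_add_one_self[of 1] by (intro mult_right_mono) auto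
    also have "\<dots> \<le> exp (exp ((r - s) / 48))"
    proof -
      have "1 + (1::real) \<le> exp 1" by (rule exp_ge_add_one_self)
      also have "exp 1 \<le> exp ((r - s) / 48)" using s by simp
      finally show ?thesis by (simp flip: exp_add)
    qed
    also have "\<dots> \<le> G (r - s)" using s by (intro G_lower) simp
    finally show ?thesis .
  qed
  moreover have "1 / (1 - q) = r / s" using q(3) by simp
  ultimately have "G (r - s) \<le> 2 * (C * (r / s))" by simp
  then show ?thesis by (simp add: C_def mult_ac)
qed

section \<open>Connected sets that cross an annulus, and the spider's web\<close>

text \<open>If the ratio exceeded 9/8 at all these radii, 40 steps of length
  \<open>49/1960 = 1/40\<close> would multiply \<open>ln G\<close> by at least \<open>3^4\<close> on
  each unit interval, faster than \<open>ln (G r) <= exp r\<close> permits.\<close>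

lemma slow_growth_radius:
  assumes "48 \<le> x"
  shows "\<exists>r. x \<le> r \<and> r \<le> 2 * x \<and> ln (G (r + 48 / 1960)) \<le> 9 / 8 * ln (G (r - 1 / 1960))"
proof (rule ccontr)
  assume "\<not> ?thesis"
  then have grow: "9 / 8 * ln (G (r - 1 / 1960)) < ln (G (r + 48 / 1960))" if "x \<le> r" "r \<le> 2 * x" for r
    using that by force
  define N where "N = nat \<lfloor>x - 1\<rfloor>"
  have N: "x - 2 \<le> real N" "real N \<le> x - 1" using assms by (auto simp: N_def) linarith+
  have iter: "(9 / 8) ^ j * ln (G x) \<le> ln (G (x + real j / 40))" if "j \<le> 40 * N" for j
    using that
  proof (induction j)
    case (Suc j)
    have "real j \<le> 40 * real N" using Suc.prems by simp
    then have "x + real j / 40 + 1 / 1960 \<le> 2 * x" using N by simp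
    from grow[OF _ this]
    have "9 / 8 * ln (G (x + real j / 40)) < ln (G (x + real j / 40 + 1 / 1960 + 48 / 1960))"
      by simp
    also have "x + real j / 40 + 1 / 1960 + 48 / 1960 = x + real (Suc j) / 40" by (simp add: field_simps)
    finally show ?case using Suc by simp
  qed simp
  have "1 \<le> ln (G x)" using ln_G_lower[OF assms] assms order.trans[OF exp_ge_add_one_self[of "x / 48"]] by force
  have "exp (4 * real N) = (exp 1 ^ 4) ^ N" by (simp flip: exp_of_nat_mult exp_of_nat2_mult)
  also have "\<dots> \<le> (3 ^ 4) ^ N" by (intro power_mono exp_le) auto
  also have "\<dots> \<le> ((9 / 8) ^ 40) ^ N" by (intro power_mono) (simp_all add: power_divide)
  also have "\<dots> \<le> ((9 / 8) ^ 40) ^ N * ln (G x)" using \<open>1 \<le> ln (G x)\<close> by simp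
  also have "\<dots> \<le> ln (G (x + real N))" using iter[of "40 * N"] by (simp add: power_mult)
  also have "\<dots> \<le> exp (x + real N)" using assms by (intro ln_G_upper) auto
  finally show False using N assms by simp
qed

text \<open>At a point \<open>z0\<close> of \<open>K\<close> on a circle of slow growth, the lower
  bound for \<open>|g|\<close> near \<open>z0\<close> is transferred to \<open>K\<close>. With
  \<open>X = ln (G (r - \<sigma>))\<close>, a degree of about \<open>X / 8\<close> suffices, at a
  cost of about \<open>exp (3 X / 8)\<close>.\<close>

lemma crossing:
  "\<forall>\<^sub>F x in at_top. \<forall>K. connected K \<longrightarrow> (\<exists>z\<in>K. norm z \<le> x) \<longrightarrow> (\<exists>z\<in>K. 3 * x \<le> norm z)
     \<longrightarrow> (\<exists>z\<in>K. sqrt (G (x / 2)) \<le> norm (g z))"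
proof -
  \<comment> \<open>Bounds \<open>l = ln (4 C)\<close> in terms of \<open>x\<close> alone, through
    \<open>r <= 2 x\<close>; it is almost linear, whereas \<open>X\<close> grows
    exponentially.\<close>
  define \<Lambda> where "\<Lambda> x = ln 16 + 32 * 1960 * (2 * x) + ln (1960 * (2 * x))" for x :: real
  have "\<forall>\<^sub>F x in at_top. 8 * (4 * \<Lambda> x + 4) \<le> exp ((x - 1) / 48) \<and> 60 \<le> x"
    unfolding \<Lambda>_def by (intro eventually_conj; real_asymp)
  then show ?thesis
  proof (eventually_elim, intro allI impI)
    fix x :: real and K :: "complex set"
    assume x: "8 * (4 * \<Lambda> x + 4) \<le> exp ((x - 1) / 48) \<and> 60 \<le> x"
      and K: "connected K" and "\<exists>z\<in>K. norm z \<le> x" and "\<exists>z\<in>K. 3 * x \<le> norm z"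
    then obtain u w where uw: "u \<in> K" "norm u \<le> x" "w \<in> K" "3 * x \<le> norm w" by blast
    define \<sigma> :: real where "\<sigma> = 1 / 1960"
    obtain r where r: "x \<le> r" "r \<le> 2 * x" "ln (G (r + 48 * \<sigma>)) \<le> 9 / 8 * ln (G (r - \<sigma>))"
      using slow_growth_radius[of x] x by (auto simp: \<sigma>_def)
    have \<sigma>: "0 < \<sigma>" "\<sigma> < 1" by (auto simp: \<sigma>_def)
    obtain z0 where z0: "z0 \<in> K" "norm z0 = r"
    proof -
      have "connected (norm ` K)" by (intro connected_continuous_image continuous_intros K)
      then have "{norm u..norm w} \<subseteq> norm ` K" by (rule connected_contains_Icc) (use uw in auto)
      moreover have "r \<in> {norm u..norm w}" using uw r x by auto
      ultimately have "r \<in> norm ` K" by blast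
      then show ?thesis using that by auto
    qed
    define X where "X = ln (G (r - \<sigma>))"
    define C where "C = 4 * exp (32 * r / \<sigma>) * (r / \<sigma>)"
    define l where "l = ln (4 * C)"
    have Gpos: "0 < G (r - \<sigma>)" "0 < G (r + 48 * \<sigma>)" using r x \<sigma> by (auto intro!: G_pos)
    have "C > 0" using r x \<sigma> by (auto simp: C_def)
    have C4: "4 * C = 16 * exp (32 * 1960 * r) * (1960 * r)"
      by (simp add: C_def \<sigma>_def)
    have ln3: "ln (p * exp q * y) = ln p + q + ln y" if "0 < p" "0 < y" for p q y :: real
      using that by (simp add: ln_mult)
    have "l = ln 16 + 32 * 1960 * r + ln (1960 * r)"
      unfolding l_def C4 by (rule ln3) (use r x in auto)
    also have "\<dots> \<le> \<Lambda> x" unfolding \<Lambda>_def using r x by (intro add_mono) auto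
    finally have "l \<le> \<Lambda> x" .
    have "exp ((x - 1) / 48) \<le> exp ((r - \<sigma>) / 48)" using r \<sigma> by simp
    also have "\<dots> \<le> X" unfolding X_def using r x \<sigma> by (intro ln_G_lower) auto
    finally have "8 * (4 * \<Lambda> x + 4) \<le> X" by (rule order.trans[OF conjunct1[OF x]])
    \<comment> \<open>Constants and \<open>C\<close> cost at most \<open>X / 8\<close> in the
      exponent and \<open>12^n\<close> another \<open>3 X / 8\<close>, which leaves
      \<open>X / 2\<close>.\<close>
    then have X: "4 * l + 4 \<le> X / 8" using \<open>l \<le> \<Lambda> x\<close> by (simp add: field_simps)
    have "1 \<le> r / \<sigma>" using r x \<sigma> by simp
    moreover have "1 \<le> exp (32 * r / \<sigma>)" using r x \<sigma> by simp
    ultimately have "1 * 1 \<le> exp (32 * r / \<sigma>) * (r / \<sigma>)" by (intro mult_mono) auto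
    then have "0 \<le> l" unfolding l_def by (intro ln_ge_zero) (simp add: C_def)
    show "\<exists>z\<in>K. sqrt (G (x / 2)) \<le> norm (g z)"
    proof (rule ccontr)
      define B where "B = sqrt (G (x / 2))"
      assume "\<not> ?thesis"
      then have B: "norm (g z) \<le> B" if "z \<in> K" for z using that by (force simp: B_def)
      \<comment> \<open>Large enough that the remainder \<open>C * 2 M / 4^n\<close> is at most half
        of \<open>exp X\<close>, given \<open>M <= exp (9/8 X)\<close> from the choice of
        \<open>r\<close>.\<close>
      define n where "n = nat \<lceil>l + X / 8\<rceil>"
      have n: "l + X / 8 \<le> real n" "real n \<le> l + X / 8 + 1" "0 < n"
        using \<open>0 \<le> l\<close> X by (auto simp: n_def)
      define M where "M = G (r + 48 * \<sigma>)"
      have "norm (g z1) \<le> 12 ^ n * B + 2 * M / 4 ^ n" if z1: "norm (z1 - z0) \<le> \<sigma>" for z1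
      proof (rule two_constants_on_connected[OF holomorphic_g \<sigma>(1) n(3) _ K z0(1) uw(3) _ B z1])
        show "norm (g z) \<le> M" if "norm (z - z0) \<le> 48 * \<sigma>" for z
        proof -
          have "norm z \<le> r + 48 * \<sigma>" using that norm_triangle_ineq2[of z z0] z0 by simp
          then show ?thesis unfolding M_def using norm_g_le[of z] G_mono[of "norm z" "r + 48 * \<sigma>"] by simp
        qed
        show "\<sigma> \<le> norm (w - z0)" using uw z0 r x \<sigma> norm_triangle_ineq2[of w z0] by simp
      qed auto
      from G_le_local_sup[OF z0(2) \<sigma>(1) _ this]
      have main: "exp X \<le> C * (12 ^ n * B + 2 * M / 4 ^ n)"
        using r x \<sigma> Gpos by (simp add: C_def X_def)
      have "M = exp (ln M)" using Gpos by (simp add: M_def)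
      also have "\<dots> \<le> exp (9 / 8 * X)" using r by (simp add: M_def X_def)
      finally have M: "M \<le> exp X * exp (X / 8)" by (simp flip: exp_add)
      have "4 * C * exp (X / 8) = exp (l + X / 8)"
        using \<open>C > 0\<close> by (simp add: l_def exp_add)
      also have "\<dots> \<le> exp (real n)" using n by simp
      also have "\<dots> = exp 1 ^ n" by (simp flip: exp_of_nat_mult)
      also have "\<dots> \<le> 4 ^ n" using exp_le by (intro power_mono) auto
      finally have four: "4 * C * exp (X / 8) \<le> 4 ^ n" .
      have "C * (2 * M / 4 ^ n) \<le> exp X / 2"
      proof -
        have "4 * C * M \<le> 4 * C * (exp X * exp (X / 8))" using M \<open>C > 0\<close> by simp
        also have "\<dots> \<le> exp X * 4 ^ n" using mult_left_mono[OF four, of "exp X"] by (simp add: mult_ac)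
        finally show ?thesis by (simp add: field_simps)
      qed
      then have "exp X \<le> 2 * C * (12 ^ n * B)" using main by (simp add: distrib_left)
      also have "\<dots> \<le> exp (1 + l + 3 * (l + X / 8 + 1)) * B"
      proof -
        have "2 * C \<le> exp (1 + l)"
          using \<open>C > 0\<close> exp_ge_add_one_self[of 1] mult_mono[of 2 "exp 1" C "4 * C"]
          by (simp add: l_def exp_add)
        moreover have "(12::real) ^ n \<le> exp (3 * (l + X / 8 + 1))"
        proof -
          have "(12::real) \<le> (5 / 2) ^ 3" by (simp add: power3_eq_cube)
          also have "\<dots> \<le> exp 1 ^ 3"
            using exp_lower_Taylor_quadratic[of 1] by (intro power_mono) auto
          finally have "(12::real) ^ n \<le> (exp 1 ^ 3) ^ n" by (intro power_mono) auto
          also have "\<dots> = exp (3 * real n)" by (simp flip: exp_of_nat_mult exp_of_nat2_mult)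
          also have "\<dots> \<le> exp (3 * (l + X / 8 + 1))" using n by simp
          finally show ?thesis .
        qed
        ultimately have "2 * C * 12 ^ n \<le> exp (1 + l) * exp (3 * (l + X / 8 + 1))"
          using \<open>C > 0\<close> by (intro mult_mono) auto
        moreover have "0 \<le> B" using x by (simp add: B_def G_nonneg)
        ultimately have "2 * C * 12 ^ n * B \<le> exp (1 + l) * exp (3 * (l + X / 8 + 1)) * B"
          by (rule mult_right_mono)
        then show ?thesis by (simp only: exp_add[of "1 + l"] mult.assoc)
      qed
      finally have "exp (X - (1 + l + 3 * (l + X / 8 + 1))) \<le> B"
        unfolding exp_diff[of X] by (subst pos_divide_le_eq) (simp_all only: exp_gt_zero mult.commute)
      moreover have "X / 2 \<le> X - (1 + l + 3 * (l + X / 8 + 1))" using X by simp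
      then have "exp (X / 2) \<le> exp (X - (1 + l + 3 * (l + X / 8 + 1)))" by simp
      moreover have "B < sqrt (G (r - \<sigma>))"
        unfolding B_def using r x \<sigma> by (intro real_sqrt_less_mono G_strict_mono) auto
      moreover have "sqrt (G (r - \<sigma>)) = exp (X / 2)"
        using Gpos by (intro real_sqrt_unique) (auto simp: X_def simp flip: exp_double)
      ultimately show False by linarith
    qed
  qed
qed

text \<open>By induction \<open>g^n(K)\<close> contains a point of modulus at least
  \<open>3 y^2\<close>, where \<open>y = G^n(S)\<close>, while \<open>|g^n(0)| <= y\<close>.
  Crossing with \<open>x = y^2\<close>, together with
  \<open>3 (G y)^2 <= sqrt (G (y^2 / 2))\<close>, continues the induction.\<close>

lemma spiders_web_g:
  assumes "0 < R"
  shows "spiders_web (A_set R g)"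
proof -
  obtain x0 where x0: "\<And>x K. \<lbrakk>x0 \<le> x; connected K; \<exists>z\<in>K. norm z \<le> x; \<exists>z\<in>K. 3 * x \<le> norm z\<rbrakk>
      \<Longrightarrow> \<exists>z\<in>K. sqrt (G (x / 2)) \<le> norm (g z)"
    using crossing unfolding eventually_at_top_linorder by blast
  have "\<forall>\<^sub>F y :: real in at_top. 9 * exp (4 * exp y) \<le> exp (exp (y\<^sup>2 / 2 / 48)) \<and> y \<le> exp (exp (y / 48))
      \<and> x0 \<le> y\<^sup>2 \<and> 96 \<le> y\<^sup>2 \<and> 48 \<le> y"
    by (intro eventually_conj; real_asymp)
  \<comment> \<open>The first condition yields \<open>step\<close>, the second keeps the iterates of
    \<open>G\<close> above their start, and the others admit \<open>crossing\<close> and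
    \<open>G_lower\<close>.\<close>
  then obtain S0 where S0: "\<And>y. S0 \<le> y \<Longrightarrow> 9 * exp (4 * exp y) \<le> exp (exp (y\<^sup>2 / 2 / 48)) \<and> y \<le> exp (exp (y / 48))
      \<and> x0 \<le> y\<^sup>2 \<and> 96 \<le> y\<^sup>2 \<and> 48 \<le> y"
    unfolding eventually_at_top_linorder by blast
  have iter_ge: "S \<le> (G ^^ n) S" if "S0 \<le> S" for n S
  proof (induction n)
    case (Suc n)
    have "(G ^^ n) S \<le> exp (exp ((G ^^ n) S / 48))" "48 \<le> (G ^^ n) S"
      using S0[of "(G ^^ n) S"] Suc that by auto
    then show ?case using G_lower[of "(G ^^ n) S"] Suc by simp
  qed simp
  have iter_nonneg: "0 \<le> (G ^^ n) 0" for n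
    by (induction n) (auto simp: G_nonneg)
  have iter_mono: "(G ^^ n) 0 \<le> (G ^^ n) S" if "0 \<le> S" for n S
    by (induction n) (auto simp: that iter_nonneg intro!: G_mono)
  have norm_iter: "norm ((g ^^ n) 0) \<le> (G ^^ n) 0" for n
  proof (induction n)
    case (Suc n)
    then show ?case using order.trans[OF norm_g_le G_mono[OF norm_ge_zero Suc]] by simp
  qed simp
  have cont_iter: "continuous_on T (g ^^ n)" for n T
  proof (induction n)
    case (Suc n)
    then show ?case using continuous_on_compose[OF Suc continuous_g] by (simp add: o_def)
  qed (simp add: id_def continuous_on_id)
  have step: "3 * (G y)\<^sup>2 \<le> sqrt (G (y\<^sup>2 / 2))" if "S0 \<le> y" for y
  proof (rule real_le_rsqrt)
    note y = S0[OF that]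
    have "(3 * (G y)\<^sup>2)\<^sup>2 = 9 * G y ^ 4" by (simp add: power_mult_distrib)
    also have "\<dots> \<le> 9 * exp (exp y) ^ 4"
      using y by (intro mult_left_mono power_mono G_upper G_nonneg) auto
    also have "\<dots> = 9 * exp (4 * exp y)" by (simp flip: exp_of_nat_mult)
    also have "\<dots> \<le> exp (exp (y\<^sup>2 / 2 / 48))" using y by simp
    also have "\<dots> \<le> G (y\<^sup>2 / 2)" using y by (intro G_lower) simp
    finally show "(3 * (G y)\<^sup>2)\<^sup>2 \<le> G (y\<^sup>2 / 2)" .
  qed
  have "spiders_web {z. \<forall>n\<ge>1. (G ^^ n) R \<le> norm ((g ^^ n) z)}"
  proof (rule spiders_web_criterion[OF holomorphic_g norm_g_le _ G_nonneg \<open>0 < R\<close>])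
    show "strict_mono_on {0..} G" by (auto simp: strict_mono_on_def G_strict_mono)
    show "0 < max S0 1" by simp
    fix S assume S: "max S0 1 \<le> S"
    show "\<exists>\<rho>. \<forall>K. connected K \<longrightarrow> 0 \<in> K \<longrightarrow> (\<exists>w\<in>K. \<rho> \<le> norm w)
        \<longrightarrow> (\<forall>n. \<exists>z\<in>K. (G ^^ n) S \<le> norm ((g ^^ n) z))"
    proof (intro exI[of _ "3 * S\<^sup>2"] allI impI)
      fix K :: "complex set" and n assume K: "connected K" "0 \<in> K" "\<exists>w\<in>K. 3 * S\<^sup>2 \<le> norm w"
      have "\<exists>z\<in>K. 3 * ((G ^^ n) S)\<^sup>2 \<le> norm ((g ^^ n) z)"
      proof (induction n)
        case (Suc n)
        let ?y = "(G ^^ n) S"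
        have y: "S0 \<le> ?y" using iter_ge[of S n] S by simp
        note y' = S0[OF y]
        have "norm ((g ^^ n) 0) \<le> ?y\<^sup>2"
        proof -
          have "norm ((g ^^ n) 0) \<le> ?y" using norm_iter iter_mono[of S n] S0[of S] S order.trans by fastforce
          also have "\<dots> \<le> ?y\<^sup>2" using y' by (simp add: power2_eq_square)
          finally show ?thesis .
        qed
        then have "\<exists>z\<in>(g ^^ n) ` K. sqrt (G (?y\<^sup>2 / 2)) \<le> norm (g z)"
          using y' K Suc by (intro x0 connected_continuous_image cont_iter) auto
        then show ?case using step[OF y] by force
      qed (use K in simp)
      then obtain z where "z \<in> K" "3 * ((G ^^ n) S)\<^sup>2 \<le> norm ((g ^^ n) z)" by blast
      moreover have "(G ^^ n) S \<le> 3 * ((G ^^ n) S)\<^sup>2"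
        using iter_ge[of S n] S S0[of "(G ^^ n) S"] by (simp add: power2_eq_square)
      ultimately show "\<exists>z\<in>K. (G ^^ n) S \<le> norm ((g ^^ n) z)" by force
    qed
  qed
  moreover have "((\<lambda>r. max_modulus r g) ^^ n) R = (G ^^ n) R \<and> 0 \<le> (G ^^ n) R" for n
    by (induction n) (use \<open>0 < R\<close> in \<open>auto simp: max_modulus_g G_nonneg\<close>)
  ultimately show ?thesis by (simp add: A_set_def)
qed

end

section \<open>The coefficients of \<open>exp (exp z - 1)\<close>\<close>

text \<open>The function satisfies \<open>f' = exp * f\<close>; comparing coefficients gives the
  recurrence, whose positive terms make all coefficients real and positive.\<close>

lemma bell_egf_coeffs:
  fixes b :: "nat \<Rightarrow> complex"
  assumes b: "\<And>z. (\<lambda>n. b n * z ^ n) sums exp (exp z - 1)"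
  obtains \<beta> :: "nat \<Rightarrow> real" where "\<And>n. b n = of_real (\<beta> n)" "\<And>n. 0 < \<beta> n" "\<beta> 0 = 1"
    "\<And>n. real (Suc n) * \<beta> (Suc n) = (\<Sum>k\<le>n. \<beta> (n - k) / fact k)"
proof -
  define f where "f z = exp (exp z - 1)" for z :: complex
  have F: "f has_fps_expansion Abs_fps b"
    by (rule has_fps_expansionI) (use b in \<open>simp add: f_def\<close>)
  have "deriv f = (\<lambda>z. exp (1 * z) * f z)"
    by (rule ext, rule DERIV_imp_deriv, unfold f_def[abs_def]) (auto intro!: derivative_eq_intros)
  then have "fps_deriv (Abs_fps b) = fps_exp 1 * Abs_fps b"
    using has_fps_expansion_deriv[OF F] has_fps_expansion_mult[OF has_fps_expansion_exp[of 1] F]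
    by (metis fps_expansion_unique_complex)
  then have "fps_nth (fps_deriv (Abs_fps b)) n = fps_nth (fps_exp 1 * Abs_fps b) n" for n by simp
  moreover have "fps_nth (fps_exp 1 * Abs_fps b) n = (\<Sum>k\<le>n. b (n - k) / fact k)" for n
    unfolding fps_mult_nth atLeast0AtMost by (intro sum.cong) simp_all
  ultimately have rec: "of_nat (Suc n) * b (Suc n) = (\<Sum>k\<le>n. b (n - k) / fact k)" for n
    by simp
  have b0: "b 0 = 1" using b[of 0] sums_unique2[OF b[of 0] powser_sums_zero[of b]] by simp
  have b_Suc: "b (Suc n) = (\<Sum>k\<le>n. b (n - k) / fact k) / of_nat (Suc n)" for n
    using rec[of n] by (metis nonzero_mult_div_cancel_left of_nat_eq_0_iff nat.distinct(1))
  have real: "b n = of_real (Re (b n)) \<and> 0 < Re (b n)" for n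
  proof (induction n rule: less_induct)
    case (less n)
    show ?case
    proof (cases n)
      case (Suc j)
      define s where "s = (\<Sum>k\<le>j. Re (b (j - k)) / fact k)"
      have "(\<Sum>k\<le>j. b (j - k) / fact k) = (\<Sum>k\<le>j. of_real (Re (b (j - k)) / fact k))"
      proof (rule sum.cong[OF refl])
        fix k
        have "b (j - k) = of_real (Re (b (j - k)))" using less[of "j - k"] Suc by simp
        then show "b (j - k) / fact k = of_real (Re (b (j - k)) / fact k)"
          by (metis of_real_divide of_real_fact)
      qed
      then have "b n = of_real (s / real (Suc j))"
        unfolding Suc b_Suc s_def by simp
      moreover have "0 < s" unfolding s_def
        by (rule sum_pos) (use less Suc in auto)
      ultimately show ?thesis by simp
    qed (simp add: b0)
  qed
  show ?thesis
  proof (rule that[of "\<lambda>n. Re (b n)"])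
    show "real (Suc n) * Re (b (Suc n)) = (\<Sum>k\<le>n. Re (b (n - k)) / fact k)" for n
    proof -
      have "(\<Sum>k\<le>n. b (n - k) / fact k) = of_real (\<Sum>k\<le>n. Re (b (n - k)) / fact k)"
        unfolding of_real_sum of_real_divide of_real_fact using real by (intro sum.cong) (metis, metis)
      then have "of_real (real (Suc n) * Re (b (Suc n))) = (of_real (\<Sum>k\<le>n. Re (b (n - k)) / fact k) :: complex)"
        using rec[of n] real[of "Suc n"] by (metis of_real_mult of_real_of_nat_eq)
      then show ?thesis by (simp only: of_real_eq_iff)
    qed
  qed (use real b0 in auto)
qed

text \<open>Multiplied by \<open>(m k)!\<close>, the bound is the number of partitions of a set of \<open>m k\<close> elements into
  \<open>k\<close> blocks of size \<open>m\<close>.\<close>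

lemma bell_egf_lower_bound:
  fixes \<beta> :: "nat \<Rightarrow> real"
  assumes "\<And>n. 0 < \<beta> n" "\<beta> 0 = 1"
    and rec: "\<And>n. real (Suc n) * \<beta> (Suc n) = (\<Sum>k\<le>n. \<beta> (n - k) / fact k)"
    and "0 < m"
  shows "1 / (fact k * fact m ^ k) \<le> \<beta> (m * k)"
proof (induction k)
  case (Suc k)
  obtain j where j: "m = Suc j" using \<open>0 < m\<close> gr0_implies_Suc by blast
  define n where "n = m * k + j"
  have n: "Suc n = m * Suc k" by (simp add: n_def j)
  \<comment> \<open>Only the term \<open>i = m - 1\<close> of the recurrence is kept: the block of a
    given element has \<open>m - 1\<close> further elements.\<close>
  have "(\<Sum>i\<in>{j}. \<beta> (n - i) / fact i) \<le> (\<Sum>i\<le>n. \<beta> (n - i) / fact i)"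
    by (rule sum_mono2) (use assms(1) in \<open>auto simp: n_def less_imp_le\<close>)
  then have "\<beta> (m * k) / fact j \<le> real (Suc n) * \<beta> (Suc n)"
    unfolding rec by (simp add: n_def)
  with Suc have "1 / (fact k * fact m ^ k) / fact j \<le> real (m * Suc k) * \<beta> (m * Suc k)"
    unfolding n by (meson divide_right_mono fact_ge_zero order.trans)
  then have "1 / (fact k * fact m ^ k) / fact j / real (m * Suc k) \<le> \<beta> (m * Suc k)"
    using \<open>0 < m\<close> by (subst pos_divide_le_eq) (simp_all add: mult.commute del: of_nat_mult)
  moreover have "fact (Suc k) * fact m ^ Suc k = fact k * fact m ^ k * fact j * real (m * Suc k)"
    by (simp add: j) (simp add: algebra_simps)
  ultimately show ?case by (simp only: divide_divide_eq_left)
qed (use assms in simp)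

text \<open>With \<open>m = p^2\<close> and \<open>k = 4^m = (2^m)^2\<close> the exponent
  \<open>m k\<close> is a square. As \<open>k! m!^k <= k^k m^(m k)\<close>, its term is at least
  \<open>(12^m / k)^k = 3^(m k) >= exp k\<close> when \<open>12 m <= r\<close>.\<close>

lemma square_term_lower_bound:
  fixes \<beta> :: "nat \<Rightarrow> real"
  assumes \<beta>: "\<And>m k. 0 < m \<Longrightarrow> 1 / (fact k * fact m ^ k) \<le> \<beta> (m * k)"
    and "48 \<le> r"
  shows "\<exists>n. exp (exp (r / 48)) \<le> \<beta> (n\<^sup>2) * r ^ (n\<^sup>2)"
proof -
  \<comment> \<open>\<open>p\<close> is the largest integer with \<open>12 p^2 <= r\<close>; as
    \<open>q >= 2\<close>, rounding loses at most a factor 2, so \<open>m >= r / 48\<close> and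
    \<open>k >= exp (r / 48)\<close>.\<close>
  define q where "q = sqrt (r / 12)"
  have q: "2 \<le> q" "q\<^sup>2 = r / 12" using \<open>48 \<le> r\<close> by (auto simp: q_def intro: real_le_rsqrt)
  define p where "p = nat \<lfloor>q\<rfloor>"
  have p: "q - 1 \<le> real p" "real p \<le> q" using q by (auto simp: p_def)
  define m k where "m = p\<^sup>2" and "k = (4::nat) ^ m"
  have m_le: "12 * real m \<le> r"
    using power_mono[OF p(2), of 2] q by (simp add: m_def)
  have m_ge: "r / 48 \<le> real m"
  proof -
    have "q / 2 \<le> real p" using p q by linarith
    then have "(q / 2)\<^sup>2 \<le> (real p)\<^sup>2" using q by (intro power_mono) auto
    then show ?thesis by (simp add: m_def q(2) power_divide)
  qed
  then have "0 < m" using \<open>48 \<le> r\<close> by (intro Nat.gr0I) auto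
  have "exp (real k) = exp 1 ^ k" by (simp flip: exp_of_nat_mult)
  also have "\<dots> \<le> (12 ^ m / real k) ^ k"
  proof (intro power_mono)
    have "exp 1 \<le> (3::real) ^ 1" using exp_le by simp
    also have "\<dots> \<le> 3 ^ m" using \<open>0 < m\<close> by (intro power_increasing) auto
    also have "3 ^ m = (12::real) ^ m / real k" by (simp add: k_def flip: power_divide)
    finally show "exp 1 \<le> (12::real) ^ m / real k" .
  qed simp
  also have "\<dots> \<le> (r ^ m / real m ^ m / real k) ^ k"
  proof (intro power_mono divide_right_mono)
    have "12 ^ m \<le> (r / real m) ^ m"
      using m_le \<open>0 < m\<close> by (intro power_mono) (auto simp: field_simps)
    then show "12 ^ m \<le> r ^ m / real m ^ m" by (simp add: power_divide)
  qed auto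
  also have "\<dots> = r ^ (m * k) / (real k ^ k * (real m ^ m) ^ k)"
    by (simp add: power_divide power_mult power_mult_distrib mult.commute[of "real k ^ k"])
  also have "\<dots> \<le> r ^ (m * k) / (fact k * fact m ^ k)"
    using fact_le_power[of k, where ?'a = real] fact_le_power[of m, where ?'a = real] \<open>48 \<le> r\<close> \<open>0 < m\<close>
    by (intro divide_left_mono mult_mono power_mono mult_pos_pos) (auto simp: k_def)
  also have "\<dots> \<le> \<beta> (m * k) * r ^ (m * k)"
    using mult_right_mono[OF \<beta>[OF \<open>0 < m\<close>, of k], of "r ^ (m * k)"] \<open>48 \<le> r\<close> by simp
  also have "m * k = (p * 2 ^ m)\<^sup>2"
    unfolding m_def k_def power_mult_distrib by (simp add: power2_eq_square flip: power_mult_distrib)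
  finally have "exp (real k) \<le> \<beta> ((p * 2 ^ m)\<^sup>2) * r ^ ((p * 2 ^ m)\<^sup>2)" .
  moreover have "exp (r / 48) \<le> real k"
  proof -
    have "exp (r / 48) \<le> exp (real m)" using m_ge by simp
    also have "\<dots> = exp 1 ^ m" by (simp flip: exp_of_nat_mult)
    also have "\<dots> \<le> 4 ^ m" using exp_le by (intro power_mono) auto
    finally show ?thesis by (simp add: k_def)
  qed
  ultimately show ?thesis by (meson exp_le_cancel_iff order.trans)
qed

theorem theorem6p2:
  fixes f g :: "complex \<Rightarrow> complex" and b :: "nat \<Rightarrow> complex"
  assumes f: "\<And>z. f z = exp (exp z - 1)"
    and b: "\<And>z. (\<lambda>n. b n * z ^ n) sums f z"
    and g: "\<And>z. g z = (\<Sum>n. b (n ^ 2) * z ^ (n ^ 2))"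
  shows "transcendental_entire g \<and> log_regular g \<and> growth_order g = \<infinity> \<and>
    (\<forall>R>0. (\<forall>r\<ge>R. max_modulus r g > r) \<longrightarrow> spiders_web (A_set R g))"
proof -
  obtain \<beta> where \<beta>: "\<And>n. b n = of_real (\<beta> n)" "\<And>n. 0 < \<beta> n" "\<beta> 0 = 1"
      "\<And>n. real (Suc n) * \<beta> (Suc n) = (\<Sum>k\<le>n. \<beta> (n - k) / fact k)"
    using bell_egf_coeffs[OF b[unfolded f]] by metis
  have sums: "(\<lambda>n. \<beta> n * r ^ n) sums exp (exp r - 1)" for r
  proof -
    have "exp (exp (of_real r) - 1) = (of_real (exp (exp r - 1)) :: complex)"
      by (metis exp_of_real of_real_1 of_real_diff)
    then have "(\<lambda>n. of_real (\<beta> n * r ^ n)) sums (of_real (exp (exp r - 1)) :: complex)"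
      using b[of "of_real r"] by (simp add: f \<beta>(1))
    then show ?thesis by (simp only: sums_of_real_iff)
  qed
  have inj: "inj (\<lambda>n::nat. n\<^sup>2)" by (simp add: inj_def)
  have summ: "summable (\<lambda>n. \<beta> (n\<^sup>2) * r ^ (n\<^sup>2))" if "0 \<le> r" for r
    using summable_reindex[OF sums_summable[OF sums] inj, of r] \<beta>(2) that
    by (simp add: o_def less_imp_le)
  \<comment> \<open>The upper bound comes from dropping the nonsquare exponents in the series of
    \<open>exp (exp r - 1)\<close>, the lower bound from one large term.\<close>
  interpret gap: square_gap_series "\<lambda>n. \<beta> (n\<^sup>2)"
  proof
    show "0 \<le> \<beta> (n\<^sup>2)" "0 < \<beta> (1\<^sup>2)" for n using \<beta>(2) less_imp_le by blast+
    show "summable (\<lambda>n. \<beta> (n\<^sup>2) * r ^ (n\<^sup>2))" for r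
      by (rule summable_norm_cancel)
         (use summ[of "\<bar>r\<bar>"] \<beta>(2) in \<open>simp add: abs_mult power_abs less_imp_le\<close>)
    show "(\<Sum>n. \<beta> (n\<^sup>2) * r ^ (n\<^sup>2)) \<le> exp (exp r)" if "0 \<le> r" for r
    proof -
      have "(\<Sum>n. \<beta> (n\<^sup>2) * r ^ (n\<^sup>2)) \<le> (\<Sum>n. \<beta> n * r ^ n)"
        using suminf_reindex_mono[OF sums_summable[OF sums] inj, of r] \<beta>(2) that
        by (simp add: o_def less_imp_le)
      also have "\<dots> \<le> exp (exp r)" unfolding sums_unique[OF sums, symmetric] by simp
      finally show ?thesis .
    qed
    show "exp (exp (r / 48)) \<le> (\<Sum>n. \<beta> (n\<^sup>2) * r ^ (n\<^sup>2))" if r: "48 \<le> r" for r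
    proof -
      obtain n where "exp (exp (r / 48)) \<le> \<beta> (n\<^sup>2) * r ^ (n\<^sup>2)"
        using square_term_lower_bound[OF bell_egf_lower_bound[OF \<beta>(2,3,4)] r] by blast
      also have "\<dots> \<le> (\<Sum>n. \<beta> (n\<^sup>2) * r ^ (n\<^sup>2))"
        using sum_le_suminf[OF summ, of r "{n}"] r \<beta>(2) by (simp add: less_imp_le)
      finally show ?thesis .
    qed
  qed
  have "g = gap.g" by (simp add: fun_eq_iff g gap.g_def \<beta>(1))
  then show ?thesis
    using gap.transcendental_g gap.log_regular_g gap.growth_order_g gap.spiders_web_g by simp
qed

end
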